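(* Let $n\ge1$ be a fixed degree. Let $\mathring{r}_\omega$ denote the rational interpolant of degree $(n,n)$ to $\mathrm{e}^{\omega z}$ at the Chebyshev nodes on the imaginary axis, i.e., with interpolation nodes $\mathrm{i}\tau_1,\dots,\mathrm{i}\tau_{2n+1}$, where $$\tau_j=\cos\left(\frac{(2j-1)\pi}{2(2n+1)}\right),\quad j=1,\dots,2n+1.$$ Then $$\|\mathring{r}_\omega - \exp(\omega\cdot)\| = \frac{2(n!)^2 }{(2n)!(2n+1)!}\left(\frac{\omega}{2} \right)^{2n+1}+\mathcal{O}(\omega^{2n+2}),\quad \omega\to 0^+.$$
   Context: $\|r-\exp(\omega\cdot)\|:=\max_{x\in[-1,1]}|r(\mathrm{i}x)-\mathrm{e}^{\mathrm{i}\omega x}|$. Given $2n+1$ distinct nodes $\mathrm{i}x_1,\dots,\mathrm{i}x_{2n+1}$ on the imaginary axis, the rational interpolant of degree $(n,n)$ to $\mathrm{e}^{\omega z}$ is the rational function $r=p/q$, where $p,q$ are polynomials of degree $\le n$, not both identically zero, solving the linearized interpolation problem $p(\mathrm{i}x_j)=\mathrm{e}^{\mathrm{i}\omega x_j}q(\mathrm{i}x_j)$, $j=1,\dots,2n+1$. Such a pair always exists and the quotient $p/q$ (taken in irreducible form) is the same for all solutions; it satisfies $|r(\mathrm{i}x)|=1$ for $x\in\mathbb{R}$. If some $r$ that is a quotient of polynomials of degree $\le n$ satisfies $r(\mathrm{i}x_j)=\mathrm{e}^{\mathrm{i}\omega x_j}$ for all $j$, it coincides with this rational interpolant. *)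

theory Defs
  imports
    "HOL-Complex_Analysis.Complex_Analysis"
    "HOL-Computational_Algebra.Computational_Algebra"
    "HOL-Library.Landau_Symbols"
begin

definition solves_linearized ::
  "nat \<Rightarrow> (nat \<Rightarrow> real) \<Rightarrow> real \<Rightarrow> complex poly \<Rightarrow> complex poly \<Rightarrow> bool" where
  "solves_linearized n x \<omega> p q \<longleftrightarrow>
     degree p \<le> n \<and> degree q \<le> n \<and> \<not> (p = 0 \<and> q = 0) \<and>
     (\<forall>j\<in>{1..2 * n + 1}.
        poly p (\<i> * of_real (x j)) = exp (\<i> * of_real (\<omega> * x j)) * poly q (\<i> * of_real (x j)))"

text \<open>The common factor \<open>h\<close> of a linearized solution is cancelled before evaluating, since \<open>p\<close> and
  \<open>q\<close> may have common zeros, where division in HOL would return 0 instead of the value of the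
  reduced fraction.\<close>

definition is_rational_interpolant ::
  "nat \<Rightarrow> (nat \<Rightarrow> real) \<Rightarrow> real \<Rightarrow> (complex \<Rightarrow> complex) \<Rightarrow> bool" where
  "is_rational_interpolant n x \<omega> r \<longleftrightarrow>
     (\<exists>p q h P Q. solves_linearized n x \<omega> p q \<and> p = h * P \<and> q = h * Q \<and> coprime P Q \<and>
        r = (\<lambda>z. poly P z / poly Q z))"

text \<open>For distinct nodes \<open>\<i> x\<^sub>1, \<dots>, \<i> x\<^sub>2\<^sub>n\<^sub>+\<^sub>1\<close> there is exactly one such function: a linearized
  solution exists, and any two have the same reduced quotient.\<close>

definition rational_interpolant ::
  "nat \<Rightarrow> (nat \<Rightarrow> real) \<Rightarrow> real \<Rightarrow> complex \<Rightarrow> complex" where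
  "rational_interpolant n x \<omega> = (THE r. is_rational_interpolant n x \<omega> r)"

definition chebyshev_node :: "nat \<Rightarrow> nat \<Rightarrow> real" where
  "chebyshev_node n j = cos ((2 * real j - 1) * pi / (2 * (2 * real n + 1)))"

text \<open>For the rational interpolant this supremum is a maximum, because the interpolant has modulus 1
  on the imaginary axis and hence no poles there.\<close>

definition approx_error :: "(complex \<Rightarrow> complex) \<Rightarrow> real \<Rightarrow> real" where
  "approx_error r \<omega> =
     (SUP x\<in>{-1..1::real}. cmod (r (\<i> * of_real x) - exp (\<i> * of_real (\<omega> * x))))"

end

theory Submission
  imports Defs
begin

text \<open>
  Put \<open>s = \<omega> z\<close>. As \<open>\<omega> \<rightarrow> 0\<close> the interpolation nodes in the variable \<open>s\<close> merge at 0, and the interpolant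
  approaches the Pade approximant \<open>P / Q\<close> of the exponential function, whose remainder
  \<open>E = Q exp - P\<close> is \<open>\<kappa> s ^ (2 n + 1) + O(s ^ (2 n + 2))\<close> with
  \<open>\<bar>\<kappa>\<bar> = (n!)\<^sup>2 / ((2 n)! (2 n + 1)!)\<close>. Interpolation replaces the power \<open>z ^ (2 n + 1)\<close> in this remainder
  by the node polynomial \<open>W z = \<Prod> (z - a)\<close>, and for Chebyshev nodes \<open>\<bar>W\<bar>\<close> has maximum \<open>4 ^ - n\<close> on the
  segment from \<open>-\<i>\<close> to \<open>\<i>\<close>. The product \<open>\<bar>\<kappa>\<bar> \<omega> ^ (2 n + 1) 4 ^ - n\<close> is the stated leading term.

  The comparison with the Pade approximant rests on one polynomial. If \<open>p - exp q\<close> vanishes at the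
  nodes, then \<open>D = p Q - q P\<close> has degree at most \<open>2 n\<close> and equals \<open>q E\<close> at the \<open>2 n + 1\<close> nodes, so it is
  the interpolation polynomial of \<open>q E\<close>, and
  \<open>exp - p / q = (q E - D) / (q Q)\<close>
  is an ordinary polynomial interpolation error divided by a function close to a constant. Two things
  are needed to make this quantitative. Polynomial interpolation at fixed nodes is a bounded operator
  (\<open>coeff_bounded_by_interpolated_values\<close>). And \<open>q\<close>, which is defined only implicitly by a linear system,
  must be controlled: since \<open>P\<close> and \<open>Q\<close> satisfy a Bezout identity (\<open>pade_bezout\<close>), \<open>q\<close> can be recovered
  from \<open>D\<close> up to a multiple of \<open>Q\<close>, and as \<open>D\<close> is small, \<open>q\<close> is a nonzero multiple of \<open>Q\<close> up to a relative
  error \<open>O(\<omega>)\<close> (\<open>denominator_nearly_constant\<close>). In particular \<open>q\<close> has no zeros in the unit disc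
  of the variable \<open>z\<close> when \<open>\<omega>\<close> is small. The resulting expansion is \<open>interpolation_error_expansion\<close>.

  The order of vanishing of \<open>E\<close>, the value of \<open>\<kappa>\<close> and the Bezout identity all come from the fact that
  \<open>P\<close> and \<open>Q exp\<close> are solutions of the same Kummer differential equation, together with their
  Wronskian (\<open>pade_wronskian\<close>).
\<close>

section \<open>Linear systems and polynomial interpolation\<close>

text \<open>Gaussian elimination: one equation with a nonzero coefficient is used to eliminate one unknown
  from all the others, which leaves one equation and one unknown fewer.\<close>

lemma homogeneous_system_nontrivial_solution:
  fixes a :: "'j \<Rightarrow> 'i \<Rightarrow> 'a :: field"
  assumes "finite J" "finite I" "card J < card I"
  shows "\<exists>c. (\<exists>i\<in>I. c i \<noteq> 0) \<and> (\<forall>j\<in>J. (\<Sum>i\<in>I. a j i * c i) = 0)"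
  using assms
proof (induction J arbitrary: I a rule: finite_induct)
  case empty
  then obtain i where "i \<in> I" by (metis card.empty card_gt_0_iff ex_in_conv)
  then show ?case by (intro exI[of _ "\<lambda>_. 1"]) auto
next
  case (insert j0 J)
  show ?case
  proof (cases "\<forall>i\<in>I. a j0 i = 0")
    case True
    have "card J < card I" using insert by simp
    from insert.IH[OF insert.prems(1) this, of a] True show ?thesis by auto
  next
    case False
    then obtain i0 where i0: "i0 \<in> I" "a j0 i0 \<noteq> 0" by auto
    define a' where "a' j i = a j i - a j i0 * a j0 i / a j0 i0" for j i
    have "card J < card (I - {i0})" using insert i0 by simp
    from insert.IH[OF _ this, of a'] insert.prems obtain c where
      c: "\<exists>i\<in>I - {i0}. c i \<noteq> 0" "\<And>j. j \<in> J \<Longrightarrow> (\<Sum>i\<in>I - {i0}. a' j i * c i) = 0" by auto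
    define s where "s = (\<Sum>i\<in>I - {i0}. a j0 i * c i)"
    define d where "d = c(i0 := - s / a j0 i0)"
    have split: "(\<Sum>i\<in>I. a j i * d i) = (\<Sum>i\<in>I - {i0}. a j i * c i) - a j i0 * s / a j0 i0" for j
      using insert.prems i0 by (subst sum.remove[of _ i0]) (auto simp: d_def intro!: sum.cong)
    have "(\<Sum>i\<in>I. a j i * d i) = 0" if "j \<in> J" for j
    proof -
      have "(\<Sum>i\<in>I - {i0}. a' j i * c i) = (\<Sum>i\<in>I - {i0}. a j i * c i) - a j i0 * s / a j0 i0"
        by (simp add: a'_def s_def ring_distribs sum_subtractf sum_distrib_left sum_divide_distrib mult_ac)
      with c(2)[OF that] split show ?thesis by simp
    qed
    moreover have "(\<Sum>i\<in>I. a j0 i * d i) = 0" using split[of j0] i0 by (simp add: s_def)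
    moreover have "\<exists>i\<in>I. d i \<noteq> 0" using c(1) by (auto simp: d_def)
    ultimately show ?thesis by auto
  qed
qed

text \<open>The coefficients of \<open>p\<close> and \<open>q\<close> are \<open>2 n + 2\<close> unknowns, and each node imposes one homogeneous
  linear equation on them.\<close>

lemma linearized_interpolation_solvable:
  fixes x g :: "'j \<Rightarrow> 'a :: field"
  assumes "finite J" "card J < 2 * n + 2"
  shows "\<exists>p q. degree p \<le> n \<and> degree q \<le> n \<and> \<not> (p = 0 \<and> q = 0)
           \<and> (\<forall>j\<in>J. poly p (x j) = g j * poly q (x j))"
proof -
  define I where "I = Inl ` {..n} \<union> Inr ` {..n}"
  define a where "a j i = (case i of Inl k \<Rightarrow> x j ^ k | Inr k \<Rightarrow> - g j * x j ^ k)" for j i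
  have "card I = 2 * n + 2" unfolding I_def
    by (subst card_Un_disjoint) (auto simp: card_image)
  with homogeneous_system_nontrivial_solution[OF assms(1), of I a] assms(2) obtain c where
    c: "\<exists>i\<in>I. c i \<noteq> 0" "\<And>j. j \<in> J \<Longrightarrow> (\<Sum>i\<in>I. a j i * c i) = 0"
    by (auto simp: I_def)
  define p where "p = (\<Sum>k\<le>n. monom (c (Inl k)) k)"
  define q where "q = (\<Sum>k\<le>n. monom (c (Inr k)) k)"
  have "poly p (x j) = g j * poly q (x j)" if "j \<in> J" for j
  proof -
    have "(\<Sum>i\<in>I. a j i * c i) = (\<Sum>k\<le>n. x j ^ k * c (Inl k)) + (\<Sum>k\<le>n. - g j * x j ^ k * c (Inr k))"
      unfolding I_def by (subst sum.union_disjoint) (auto simp: sum.reindex a_def)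
    also have "\<dots> = poly p (x j) - g j * poly q (x j)"
      by (simp add: p_def q_def poly_sum poly_monom sum_distrib_left sum_negf mult_ac)
    finally show ?thesis using c(2)[OF that] by simp
  qed
  moreover have "\<not> (p = 0 \<and> q = 0)"
  proof
    assume *: "p = 0 \<and> q = 0"
    have "coeff p k = c (Inl k)" "coeff q k = c (Inr k)" if "k \<le> n" for k
      using that by (simp_all add: p_def q_def coeff_sum coeff_monom)
    with * have "c (Inl k) = 0 \<and> c (Inr k) = 0" if "k \<le> n" for k using that by fastforce
    with c(1) show False by (auto simp: I_def)
  qed
  moreover have "degree p \<le> n" "degree q \<le> n"
    unfolding p_def q_def by (auto intro!: degree_sum_le order.trans[OF degree_monom_le])
  ultimately show ?thesis by blast
qed

text \<open>Expanding in the Lagrange basis \<open>l a\<close> shows that interpolation on a fixed node set is a bounded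
  operator. The constant depends on the nodes only, which is what makes all later error terms uniform.\<close>

lemma coeff_bounded_by_interpolated_values:
  fixes A :: "'a :: real_normed_field set"
  assumes "finite A"
  shows "\<exists>C\<ge>0. \<forall>p B. degree p < card A \<longrightarrow> (\<forall>a\<in>A. norm (poly p a) \<le> B) \<longrightarrow>
           (\<forall>k. norm (coeff p k) \<le> C * B)"
proof -
  define l where "l a = smult (inverse (\<Prod>b\<in>A - {a}. a - b)) (\<Prod>b\<in>A - {a}. [:-b, 1:])" for a
  have l: "poly (l a) b = (if a = b then 1 else 0)" if "a \<in> A" "b \<in> A" for a b
    using assms that by (auto simp: l_def poly_prod)
  have deg: "degree (l a) \<le> card A - 1" if "a \<in> A" for a
  proof -
    have "degree (l a) \<le> degree (\<Prod>b\<in>A - {a}. [:-b, 1:])" by (simp add: l_def degree_smult_le)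
    also have "\<dots> \<le> (\<Sum>b\<in>A - {a}. degree [:-b, 1:])" using degree_prod_sum_le[of "A - {a}" "\<lambda>b. [:-b, 1:]"] assms by (simp add: o_def)
    finally show ?thesis using that assms by simp
  qed
  define C where "C = (\<Sum>a\<in>A. \<Sum>k<card A. norm (coeff (l a) k))"
  have "norm (coeff p k) \<le> C * B"
    if p: "degree p < card A" and B: "\<forall>a\<in>A. norm (poly p a) \<le> B" for p B k
  proof (cases "k < card A")
    case False
    have "A \<noteq> {}" using p by auto
    then have "B \<ge> 0" using B norm_ge_zero order.trans by blast
    moreover have "C \<ge> 0" by (auto simp: C_def intro!: sum_nonneg)
    ultimately show ?thesis using p False by (simp add: coeff_eq_0)
  next
    case k: True
    have "p = (\<Sum>a\<in>A. smult (poly p a) (l a))"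
    proof (rule poly_eqI_degree[of A])
      fix b assume "b \<in> A"
      then show "poly p b = poly (\<Sum>a\<in>A. smult (poly p a) (l a)) b"
        using assms by (simp add: poly_sum l if_distrib cong: if_cong)
    next
      have "degree (\<Sum>a\<in>A. smult (poly p a) (l a)) \<le> card A - 1"
        using assms deg by (intro degree_sum_le) (auto intro: order.trans[OF degree_smult_le])
      then show "degree (\<Sum>a\<in>A. smult (poly p a) (l a)) < card A" using p by linarith
    qed (use p in auto)
    then have "coeff p k = (\<Sum>a\<in>A. poly p a * coeff (l a) k)"
      by (metis (no_types, lifting) coeff_smult coeff_sum sum.cong)
    then have "norm (coeff p k) \<le> (\<Sum>a\<in>A. norm (poly p a * coeff (l a) k))"
      by (simp add: norm_sum)
    also have "\<dots> \<le> (\<Sum>a\<in>A. B * (\<Sum>k<card A. norm (coeff (l a) k)))"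
    proof (rule sum_mono)
      fix a assume "a \<in> A"
      then show "norm (poly p a * coeff (l a) k) \<le> B * (\<Sum>k<card A. norm (coeff (l a) k))"
        using B k member_le_sum[of k "{..<card A}" "\<lambda>k. norm (coeff (l a) k)"]
        by (auto simp: norm_mult intro!: mult_mono intro: order.trans[OF norm_ge_zero])
    qed
    finally show ?thesis by (simp add: C_def sum_distrib_left mult.commute)
  qed
  moreover have "C \<ge> 0" by (auto simp: C_def intro!: sum_nonneg)
  ultimately show ?thesis by blast
qed

section \<open>Reduced quotients of linearized solutions\<close>

text \<open>Splitting off common factors ends with a coprime pair, because every factor that is not a unit
  lowers the degree of the denominator.\<close>

lemma poly_common_factor_cancelled:
  fixes p q :: "'a :: field poly"
  assumes "q \<noteq> 0"
  shows "\<exists>h P Q. p = h * P \<and> q = h * Q \<and> coprime P Q"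
  using assms
proof (induction "degree q" arbitrary: p q rule: less_induct)
  case less
  show ?case
  proof (cases "coprime p q")
    case True
    then show ?thesis by (intro exI[of _ 1] exI[of _ p] exI[of _ q]) simp
  next
    case False
    then obtain d where d: "d dvd p" "d dvd q" "\<not> is_unit d"
      unfolding coprime_def by blast
    then obtain p' q' where pq: "p = d * p'" "q = d * q'" by (auto elim!: dvdE)
    with less.prems have "d \<noteq> 0" "q' \<noteq> 0" by auto
    with d(3) have "degree d > 0" by (auto simp: is_unit_iff_degree)
    with \<open>d \<noteq> 0\<close> \<open>q' \<noteq> 0\<close> have "degree q' < degree q" by (simp add: pq degree_mult_eq)
    from less.hyps[OF this \<open>q' \<noteq> 0\<close>, of p'] obtain h P Q where
      "p' = h * P" "q' = h * Q" "coprime P Q" by auto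
    then show ?thesis by (intro exI[of _ "d * h"] exI[of _ P] exI[of _ Q]) (simp add: pq mult.assoc)
  qed
qed

text \<open>If \<open>(p\<^sub>1, q\<^sub>1)\<close> and \<open>(p\<^sub>2, q\<^sub>2)\<close> both solve the linearized problem, then \<open>p\<^sub>1 q\<^sub>2\<close> and \<open>p\<^sub>2 q\<^sub>1\<close> have degree at
  most \<open>2 n\<close> and agree at \<open>2 n + 1\<close> nodes, so they are equal. Hence the reduced quotient is unique, and
  away from the zeros of its denominator any solution computes the interpolant. This frees the
  asymptotic analysis from reduced fractions altogether.\<close>

lemma rational_interpolant_eq_quotient:
  assumes inj: "inj_on x {1..2 * n + 1}"
    and sol: "solves_linearized n x \<omega> p q" and qz: "poly q z \<noteq> 0"
  shows "rational_interpolant n x \<omega> z = poly p z / poly q z"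
proof -
  define S where "S = (\<lambda>j. \<i> * of_real (x j) :: complex) ` {1..2 * n + 1}"
  have card_S: "card S = 2 * n + 1"
    unfolding S_def using inj by (subst card_image) (auto simp: inj_on_def)
  have cross: "p1 * q2 = p2 * q1"
    if "solves_linearized n x \<omega> p1 q1" "solves_linearized n x \<omega> p2 q2" for p1 q1 p2 q2
  proof (rule poly_eqI_degree[of S])
    show "degree (p1 * q2) < card S" "degree (p2 * q1) < card S"
      using that degree_mult_le[of p1 q2] degree_mult_le[of p2 q1] card_S
      unfolding solves_linearized_def by linarith+
  qed (use that in \<open>auto simp: S_def solves_linearized_def\<close>)
  have den_nz: "q' \<noteq> 0" if "solves_linearized n x \<omega> p' q'" for p' q'
  proof
    assume "q' = 0"
    with that have "\<And>z. z \<in> S \<Longrightarrow> poly p' z = poly 0 z" "degree p' < card S"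
      unfolding card_S by (auto simp: solves_linearized_def S_def)
    then have "p' = 0" by (intro poly_eqI_degree[of S]) (auto simp: card_S)
    with that \<open>q' = 0\<close> show False by (simp add: solves_linearized_def)
  qed
  have uniq: "r z = poly p' z / poly q' z"
    if "is_rational_interpolant n x \<omega> r" "solves_linearized n x \<omega> p' q'" "poly q' z \<noteq> 0" for r p' q' z
  proof -
    from that obtain p1 q1 h P Q where *: "solves_linearized n x \<omega> p1 q1" "p1 = h * P" "q1 = h * Q"
      "coprime P Q" "r = (\<lambda>z. poly P z / poly Q z)"
      unfolding is_rational_interpolant_def by blast
    have "h \<noteq> 0" using den_nz[OF *(1)] * by auto
    with cross[OF *(1) that(2)] * have "P * q' = p' * Q" by auto
    then have e: "poly P z * poly q' z = poly p' z * poly Q z" by (metis poly_mult)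
    with that(3) coprime_poly_0[OF *(4), of z] have "poly Q z \<noteq> 0" by auto
    with e that(3) * show ?thesis by (simp add: field_simps)
  qed
  have uniq2: "r1 = r2" if "is_rational_interpolant n x \<omega> r1" "is_rational_interpolant n x \<omega> r2" for r1 r2
  proof -
    from that(1) obtain p1 q1 h P Q where *: "solves_linearized n x \<omega> p1 q1" "p1 = h * P" "q1 = h * Q"
      "coprime P Q" "r1 = (\<lambda>z. poly P z / poly Q z)"
      unfolding is_rational_interpolant_def by blast
    from that(2) obtain p2 q2 h' P' Q' where **: "solves_linearized n x \<omega> p2 q2" "p2 = h' * P'" "q2 = h' * Q'"
      "coprime P' Q'" "r2 = (\<lambda>z. poly P' z / poly Q' z)"
      unfolding is_rational_interpolant_def by blast
    have "h \<noteq> 0" "h' \<noteq> 0" using den_nz[OF *(1)] den_nz[OF **(1)] * ** by auto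
    with cross[OF *(1) **(1)] * ** have "P * Q' = P' * Q" by auto
    then have e: "poly P z * poly Q' z = poly P' z * poly Q z" for z by (metis poly_mult)
    show ?thesis
    proof
      fix z show "r1 z = r2 z"
        using e[of z] coprime_poly_0[OF *(4), of z] coprime_poly_0[OF **(4), of z]
        by (cases "poly Q z = 0"; cases "poly Q' z = 0") (auto simp: * ** frac_eq_eq)
    qed
  qed
  have "\<exists>r. is_rational_interpolant n x \<omega> r"
  proof -
    obtain h P Q where "p = h * P" "q = h * Q" "coprime P Q"
      using poly_common_factor_cancelled[OF den_nz[OF sol], of p] by auto
    with sol show ?thesis unfolding is_rational_interpolant_def by blast
  qed
  then have "is_rational_interpolant n x \<omega> (rational_interpolant n x \<omega>)"
    unfolding rational_interpolant_def using uniq2 by (metis theI')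
  with uniq sol qz show ?thesis by blast
qed

section \<open>The Pade approximant of the exponential function\<close>

text \<open>The classical \<open>(n, n)\<close> Pade approximant of \<open>exp\<close> is \<open>P(s) / P(-s)\<close>, where \<open>P\<close> is the confluent
  hypergeometric polynomial \<open>\<^sub>1F\<^sub>1(-n; -2n; s)\<close>. Both are normalised to take the value 1 at 0.\<close>

definition pade_coeff :: "nat \<Rightarrow> nat \<Rightarrow> complex" where
  "pade_coeff n k = of_nat (n choose k) * fact (2 * n - k) / fact (2 * n)"

definition pade_num :: "nat \<Rightarrow> complex poly" where
  "pade_num n = (\<Sum>k\<le>n. monom (pade_coeff n k) k)"

definition pade_den :: "nat \<Rightarrow> complex poly" where
  "pade_den n = (\<Sum>k\<le>n. monom ((- 1) ^ k * pade_coeff n k) k)"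

definition pade_remainder :: "nat \<Rightarrow> complex fps" where
  "pade_remainder n = fps_of_poly (pade_den n) * fps_exp 1 - fps_of_poly (pade_num n)"

lemma coeff_pade_num: "coeff (pade_num n) k = pade_coeff n k"
  by (simp add: pade_num_def coeff_sum coeff_monom pade_coeff_def binomial_eq_0)

lemma coeff_pade_den: "coeff (pade_den n) k = (- 1) ^ k * pade_coeff n k"
  by (simp add: pade_den_def coeff_sum coeff_monom pade_coeff_def binomial_eq_0)

text \<open>This is the hypergeometric recurrence, kept free of divisions so that it also holds at \<open>k = n\<close>,
  where the series terminates, and beyond.\<close>

lemma pade_coeff_rec:
  "of_nat (Suc k) * (of_nat k - of_nat (2 * n)) * pade_coeff n (Suc k)
     = (of_nat k - of_nat n) * pade_coeff n k"
proof (cases "k < n")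
  case True
  then obtain m where m: "n = Suc (k + m)" by (metis less_imp_Suc_add)
  have 1: "of_nat (Suc k) * of_nat (n choose Suc k) = (of_nat (n - k) * of_nat (n choose k) :: complex)"
    by (metis binomial_absorb_comp binomial_absorption mult.commute of_nat_mult diff_Suc_1 m)
  have 2: "2 * n - k = Suc (2 * n - Suc k)" using True by simp
  have 3: "fact (2 * n - k) = of_nat (2 * n - k) * (fact (2 * n - Suc k) :: complex)"
    by (subst 2, subst fact_Suc, subst 2[symmetric]) simp
  have "of_nat (Suc k) * (of_nat k - of_nat (2 * n)) * pade_coeff n (Suc k)
     = - (of_nat (Suc k) * of_nat (n choose Suc k)) * (of_nat (2 * n - k) * fact (2 * n - Suc k)) / fact (2 * n)"
    using True by (simp add: pade_coeff_def of_nat_diff field_simps)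
  also have "\<dots> = (of_nat k - of_nat n) * pade_coeff n k"
    unfolding 1 3[symmetric] using True by (simp add: pade_coeff_def of_nat_diff field_simps)
  finally show ?thesis .
qed (auto simp: pade_coeff_def binomial_eq_0 not_less le_less)

lemma pade_coeff_nonzero: "k \<le> n \<Longrightarrow> pade_coeff n k \<noteq> 0"
  by (simp add: pade_coeff_def)

lemma pade_coeff_0: "pade_coeff n 0 = 1"
  by (simp add: pade_coeff_def)

lemma degree_pade: "degree (pade_num n) = n" "degree (pade_den n) = n"
proof -
  have "degree (pade_num n) \<le> n" "degree (pade_den n) \<le> n"
    by (auto intro!: degree_le simp: coeff_pade_num coeff_pade_den pade_coeff_def binomial_eq_0)
  moreover have "degree (pade_num n) \<ge> n" "degree (pade_den n) \<ge> n"
    by (auto intro!: le_degree simp: coeff_pade_num coeff_pade_den pade_coeff_nonzero)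
  ultimately show "degree (pade_num n) = n" "degree (pade_den n) = n" by auto
qed

text \<open>The operator of Kummer's differential equation with parameters \<open>-n\<close> and \<open>-2n\<close>.\<close>

definition kummer_op :: "nat \<Rightarrow> complex fps \<Rightarrow> complex fps" where
  "kummer_op n f = fps_X * fps_deriv (fps_deriv f) - (of_nat (2*n) + fps_X) * fps_deriv f + of_nat n * f"

lemma kummer_op_nth:
  "fps_nth (kummer_op n f) k
    = of_nat (Suc k) * (of_nat k - of_nat (2 * n)) * fps_nth f (Suc k) - (of_nat k - of_nat n) * fps_nth f k"
  unfolding kummer_op_def
  by (cases k) (simp_all add: algebra_simps fps_of_nat[symmetric] del: of_nat_Suc)

lemma kummer_op_pade_num: "kummer_op n (fps_of_poly (pade_num n)) = 0"
  by (rule fps_ext, subst kummer_op_nth)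
     (simp add: coeff_pade_num pade_coeff_rec del: of_nat_Suc of_nat_mult)

text \<open>This is Kummer's transformation: \<open>\<^sub>1F\<^sub>1(-n; -2n; -s) exp s\<close> solves the same equation as
  \<open>\<^sub>1F\<^sub>1(-n; -2n; s)\<close>. Pulling \<open>exp\<close> out of the operator leaves the equation for \<open>pade_den\<close>, which is
  the numerator's equation with \<open>s\<close> replaced by \<open>-s\<close>.\<close>

lemma kummer_op_pade_den: "kummer_op n (fps_of_poly (pade_den n) * fps_exp 1) = 0"
proof -
  let ?Q = "fps_of_poly (pade_den n)"
  have "fps_X * fps_deriv (fps_deriv ?Q) - (of_nat (2*n) - fps_X) * fps_deriv ?Q - of_nat n * ?Q = 0"
  proof (rule fps_ext)
    fix k
    have "fps_nth (fps_X * fps_deriv (fps_deriv ?Q) - (of_nat (2*n) - fps_X) * fps_deriv ?Q - of_nat n * ?Q) k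
      = of_nat (Suc k) * (of_nat k - of_nat (2 * n)) * fps_nth ?Q (Suc k) + (of_nat k - of_nat n) * fps_nth ?Q k"
      by (cases k) (simp_all add: algebra_simps fps_of_nat[symmetric] del: of_nat_Suc)
    also have "\<dots> = (- 1) ^ Suc k * (of_nat (Suc k) * (of_nat k - of_nat (2 * n)) * pade_coeff n (Suc k)
        - (of_nat k - of_nat n) * pade_coeff n k)"
      by (simp add: coeff_pade_den algebra_simps)
    also have "\<dots> = 0" by (simp only: pade_coeff_rec) simp
    finally show "fps_nth (fps_X * fps_deriv (fps_deriv ?Q) - (of_nat (2*n) - fps_X) * fps_deriv ?Q - of_nat n * ?Q) k
       = fps_nth 0 k" by simp
  qed
  moreover have "kummer_op n (?Q * fps_exp 1) =
     fps_exp 1 * (fps_X * fps_deriv (fps_deriv ?Q) - (of_nat (2*n) - fps_X) * fps_deriv ?Q - of_nat n * ?Q)"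
    by (simp add: kummer_op_def algebra_simps)
  ultimately show ?thesis by simp
qed

text \<open>The remainder is a difference of two solutions of Kummer's equation that agree at 0. The recurrence
  for the coefficients of a solution propagates the value 0 as long as its factor \<open>k - 2 n\<close> is nonzero,
  that is, up to index \<open>2 n\<close>.\<close>

lemma pade_remainder_vanishing_order:
  assumes "k \<le> 2 * n"
  shows "fps_nth (pade_remainder n) k = 0"
  using assms
proof (induction k)
  case 0
  then show ?case by (simp add: pade_remainder_def coeff_pade_num coeff_pade_den pade_coeff_0)
next
  case (Suc k)
  have "kummer_op n (pade_remainder n) = kummer_op n (fps_of_poly (pade_den n) * fps_exp 1)
      - kummer_op n (fps_of_poly (pade_num n))"
    by (simp add: kummer_op_def pade_remainder_def algebra_simps)
  then have "fps_nth (kummer_op n (pade_remainder n)) k = 0"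
    by (simp add: kummer_op_pade_num kummer_op_pade_den)
  then have "of_nat (Suc k) * (of_nat k - of_nat (2 * n)) * fps_nth (pade_remainder n) (Suc k) = 0"
    unfolding kummer_op_nth using Suc by simp
  moreover have "(of_nat k - of_nat (2 * n) :: complex) \<noteq> 0"
    using Suc.prems by (metis Suc_n_not_le_n eq_iff_diff_eq_0 of_nat_eq_iff)
  ultimately show ?case by (simp del: of_nat_Suc of_nat_mult)
qed

text \<open>Write \<open>E = Q exp - P\<close> for the remainder. Up to sign, the Wronskian of \<open>Q exp\<close> and \<open>P\<close>, divided by
  \<open>exp\<close>, is the polynomial \<open>(Q + Q') P - Q P'\<close> of degree at most \<open>2 n\<close>; on the other hand
  this equals \<open>Q E' - (Q + Q') E\<close>, which vanishes to order \<open>2 n\<close> at 0. So it is a monomial, and its coefficient can be read off in two ways: from the leading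
  coefficients of \<open>P\<close> and \<open>Q\<close>, and from the first nonzero coefficient of \<open>E\<close>. At index \<open>2 n + 1\<close> Kummer's
  recurrence degenerates and does not determine that coefficient.\<close>

lemma pade_wronskian:
  assumes "n \<ge> 1"
  shows "(pade_den n + pderiv (pade_den n)) * pade_num n - pade_den n * pderiv (pade_num n)
    = monom ((- 1) ^ n * (pade_coeff n n)\<^sup>2) (2 * n)" (is "?W = _")
    and "of_nat (2 * n + 1) * fps_nth (pade_remainder n) (2 * n + 1) = (- 1) ^ n * (pade_coeff n n)\<^sup>2"
proof -
  let ?P = "pade_num n" and ?Q = "pade_den n" and ?E = "pade_remainder n"
  let ?FQ = "fps_of_poly ?Q"
  have W: "fps_of_poly ?W = ?FQ * fps_deriv ?E - (?FQ + fps_deriv ?FQ) * ?E"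
    by (simp add: pade_remainder_def fps_of_poly_simps algebra_simps)
  have low: "fps_nth (?FQ * fps_deriv ?E) k = (if k = 2 * n then of_nat (2 * n + 1) * fps_nth ?E (2 * n + 1) else 0)"
    "fps_nth ((?FQ + fps_deriv ?FQ) * ?E) k = 0" if "k \<le> 2 * n" for k
  proof -
    have "fps_nth (?FQ * fps_deriv ?E) k = (\<Sum>i=0..k. coeff ?Q i * (of_nat (k - i + 1) * fps_nth ?E (k - i + 1)))"
      by (simp add: fps_mult_nth)
    also have "\<dots> = (\<Sum>i=0..k. if i = 0 \<and> k = 2 * n then of_nat (2 * n + 1) * fps_nth ?E (2 * n + 1) else 0)"
    proof (rule sum.cong[OF refl], goal_cases)
      case (1 i)
      then have "i = 0 \<and> k = 2 * n \<or> \<not> (i = 0 \<and> k = 2 * n) \<and> k - i + 1 \<le> 2 * n"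
        using that by auto
      then show ?case
        by (auto simp: coeff_pade_den pade_coeff_0 pade_remainder_vanishing_order)
    qed
    finally show "fps_nth (?FQ * fps_deriv ?E) k = (if k = 2 * n then of_nat (2 * n + 1) * fps_nth ?E (2 * n + 1) else 0)"
      by (cases "k = 2 * n") simp_all
    show "fps_nth ((?FQ + fps_deriv ?FQ) * ?E) k = 0"
      using that by (auto simp: fps_mult_nth pade_remainder_vanishing_order intro!: sum.neutral)
  qed
  have c1: "coeff ?W k = (if k = 2 * n then of_nat (2 * n + 1) * fps_nth ?E (2 * n + 1) else 0)"
    if "k \<le> 2 * n" for k
    using low[OF that] by (simp flip: fps_of_poly_nth add: W)
  have dP: "degree (pderiv ?P) < n" "degree (pderiv ?Q) < n"
    using assms by (simp_all add: degree_pderiv degree_pade)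
  have d1: "degree (pderiv ?Q * ?P - ?Q * pderiv ?P) < 2 * n"
    using dP assms degree_mult_le[of "pderiv ?Q" ?P] degree_mult_le[of ?Q "pderiv ?P"]
    by (intro degree_diff_less) (auto simp: degree_pade)
  have W2: "?W = ?Q * ?P + (pderiv ?Q * ?P - ?Q * pderiv ?P)" by (simp add: algebra_simps)
  have "coeff (?Q * ?P) (2 * n) = (- 1) ^ n * (pade_coeff n n)\<^sup>2"
    using coeff_mult_degree_sum[of ?Q ?P]
    by (simp add: degree_pade coeff_pade_num coeff_pade_den power2_eq_square mult_2)
  then have c2: "coeff ?W (2 * n) = (- 1) ^ n * (pade_coeff n n)\<^sup>2"
    unfolding W2 coeff_add coeff_eq_0[OF d1] by simp
  show E: "of_nat (2 * n + 1) * fps_nth ?E (2 * n + 1) = (- 1) ^ n * (pade_coeff n n)\<^sup>2"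
    using c1[of "2 * n"] c2 by simp
  have "degree ?W \<le> 2 * n"
    unfolding W2 using d1 degree_mult_le[of ?Q ?P] by (intro degree_add_le) (auto simp: degree_pade)
  show "?W = monom ((- 1) ^ n * (pade_coeff n n)\<^sup>2) (2 * n)"
  proof (intro poly_eqI)
    fix k
    show "coeff ?W k = coeff (monom ((- 1) ^ n * (pade_coeff n n)\<^sup>2) (2 * n)) k"
    proof (cases "k \<le> 2 * n")
      case True
      then show ?thesis unfolding c1[OF True] E by simp
    next
      case False
      with \<open>degree ?W \<le> 2 * n\<close> have "coeff ?W k = 0" by (intro coeff_eq_0) simp
      with False show ?thesis by simp
    qed
  qed
qed

text \<open>The Wronskian identity expresses the monomial \<open>s ^ (2 n)\<close> in terms of \<open>P\<close> and \<open>Q\<close>. Since \<open>Q\<close> has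
  constant coefficient 1, it is invertible modulo \<open>s ^ (2 n)\<close> by a geometric series, and the two facts
  combine to a Bezout identity.\<close>

lemma pade_bezout:
  assumes "n \<ge> 1"
  shows "\<exists>A B. A * pade_num n + B * pade_den n = 1"
proof -
  let ?P = "pade_num n" and ?Q = "pade_den n"
  define c where "c = (- 1) ^ n * (pade_coeff n n)\<^sup>2"
  have c: "c \<noteq> 0" by (simp add: c_def pade_coeff_nonzero)
  have "monom 1 (2 * n) = smult (1 / c) (monom c (2 * n))" using c by (simp add: smult_monom)
  also have "\<dots> = smult (1 / c) ((?Q + pderiv ?Q) * ?P - ?Q * pderiv ?P)"
    using pade_wronskian(1)[OF assms] by (simp add: c_def)
  finally have X: "[:0, 1:] ^ (2 * n) = smult (1 / c) (?Q + pderiv ?Q) * ?P - ?Q * smult (1 / c) (pderiv ?P)"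
    by (simp add: monom_altdef smult_diff_right)
  obtain a g where ag: "?Q = pCons a g" by (cases ?Q)
  then have "a = 1" using coeff_pade_den[of n 0] by (simp add: pade_coeff_0)
  with ag have Q: "1 - [:0, 1:] * - g = ?Q" by (simp add: one_pCons)
  have "1 - ([:0, 1:] * - g) ^ (2 * n) = ?Q * (\<Sum>i<2 * n. ([:0, 1:] * - g) ^ i)"
    unfolding one_diff_power_eq Q ..
  then have "1 = (- g) ^ (2 * n) * [:0, 1:] ^ (2 * n) + ?Q * (\<Sum>i<2 * n. ([:0, 1:] * - g) ^ i)"
    by (simp only: power_mult_distrib) (simp add: algebra_simps)
  also have "\<dots> = ((- g) ^ (2 * n) * smult (1 / c) (?Q + pderiv ?Q)) * ?P
     + ((\<Sum>i<2 * n. ([:0, 1:] * - g) ^ i) - (- g) ^ (2 * n) * smult (1 / c) (pderiv ?P)) * ?Q"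
    unfolding X by (simp only: algebra_simps)
  finally show ?thesis by metis
qed

lemma norm_pade_remainder_leading_coeff:
  assumes "n \<ge> 1"
  shows "cmod (fps_nth (pade_remainder n) (2 * n + 1)) = (fact n)\<^sup>2 / (fact (2 * n) * fact (2 * n + 1))"
proof -
  have a: "pade_coeff n n = of_real (fact n / fact (2 * n))"
    by (simp add: pade_coeff_def mult_2)
  have "real (2 * n + 1) * cmod (fps_nth (pade_remainder n) (2 * n + 1)) = (fact n / fact (2 * n))\<^sup>2"
    using arg_cong[OF pade_wronskian(2)[OF assms], of cmod] unfolding a
    by (simp add: norm_mult norm_power norm_divide flip: of_nat_Suc)
  moreover have "fact (2 * n + 1) = real (2 * n + 1) * fact (2 * n)" by simp
  moreover have "real (2 * n + 1) \<noteq> 0" by (simp only: of_nat_eq_0_iff)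
  ultimately show ?thesis
    by (simp add: divide_simps mult_ac power2_eq_square del: fact_Suc of_nat_Suc of_nat_add)
qed

text \<open>The terms of order at least \<open>2 n + 2\<close> in the power series of the remainder add up to
  \<open>s ^ (2 n + 2)\<close> times an entire function, which is bounded on the unit disc.\<close>

lemma pade_remainder_asymptotics:
  shows "\<exists>M>0. \<forall>s. cmod s \<le> 1 \<longrightarrow>
    cmod (poly (pade_den n) s * exp s - poly (pade_num n) s - fps_nth (pade_remainder n) (2 * n + 1) * s ^ (2 * n + 1))
      \<le> M * cmod s ^ (2 * n + 2)"
proof -
  let ?E = "pade_remainder n" and ?N = "2 * n + 1"
  define G where "G = fps_shift (?N + 1) ?E"
  have E: "?E = fps_const (fps_nth ?E ?N) * fps_X ^ ?N + G * fps_X ^ (?N + 1)"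
  proof (rule fps_ext)
    fix k
    have "k \<le> 2 * n \<or> k = ?N \<or> k \<ge> ?N + 1" by linarith
    then show "fps_nth ?E k = fps_nth (fps_const (fps_nth ?E ?N) * fps_X ^ ?N + G * fps_X ^ (?N + 1)) k"
      by (auto simp: G_def fps_X_power_mult_right_nth pade_remainder_vanishing_order numeral_2_eq_2
               simp del: power_Suc simp flip: Suc_diff_le)
  qed
  have rad: "fps_conv_radius ?E = \<infinity>"
  proof -
    have "fps_conv_radius (fps_of_poly (pade_den n) * fps_exp 1) = \<infinity>"
      using fps_conv_radius_mult[of "fps_of_poly (pade_den n)" "fps_exp 1"] by simp
    then show ?thesis
      using fps_conv_radius_diff[of "fps_of_poly (pade_den n) * fps_exp 1" "fps_of_poly (pade_num n)"]
      by (simp add: pade_remainder_def)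
  qed
  then have radG: "fps_conv_radius G = \<infinity>" by (simp add: G_def)
  have ev: "poly (pade_den n) s * exp s - poly (pade_num n) s = eval_fps ?E s" for s
    using fps_conv_radius_mult[of "fps_of_poly (pade_den n)" "fps_exp 1"]
    by (simp add: pade_remainder_def eval_fps_diff eval_fps_mult)
  have ev2: "eval_fps ?E s = fps_nth ?E ?N * s ^ ?N + eval_fps G s * s ^ (?N + 1)" for s
  proof -
    have 1: "fps_conv_radius (fps_const (fps_nth ?E ?N) * fps_X ^ ?N) = \<infinity>"
      using fps_conv_radius_mult[of "fps_const (fps_nth ?E ?N)" "fps_X ^ ?N"] by (simp del: power_Suc)
    have 3: "eval_fps (G * fps_X ^ (?N + 1)) s = eval_fps G s * s ^ (?N + 1)"
      by (subst eval_fps_mult) (simp_all add: radG del: power_Suc)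
    have 2: "fps_conv_radius (G * fps_X ^ (?N + 1)) = \<infinity>"
      using fps_conv_radius_mult[of "G" "fps_X ^ (?N + 1)"] by (simp add: radG del: power_Suc)
    have 4: "eval_fps (fps_const (fps_nth ?E ?N) * fps_X ^ ?N) s = fps_nth ?E ?N * s ^ ?N"
      by (subst eval_fps_mult) (simp_all del: power_Suc)
    have "eval_fps ?E s = eval_fps (fps_const (fps_nth ?E ?N) * fps_X ^ ?N + G * fps_X ^ (?N + 1)) s"
      using E by (rule arg_cong)
    also have "\<dots> = eval_fps (fps_const (fps_nth ?E ?N) * fps_X ^ ?N) s + eval_fps (G * fps_X ^ (?N + 1)) s"
      by (rule eval_fps_add) (simp_all only: 1 2, simp_all)
    finally show ?thesis unfolding 3 4 .
  qed
  have "continuous_on (cball 0 1) (eval_fps G)"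
    by (rule continuous_on_eval_fps') (auto simp: radG intro: continuous_intros)
  then have "bounded (eval_fps G ` cball 0 1)"
    by (intro compact_imp_bounded compact_continuous_image) auto
  then obtain M where M: "M > 0" "\<And>s. cmod s \<le> 1 \<Longrightarrow> cmod (eval_fps G s) \<le> M"
    by (auto simp: bounded_pos)
  show ?thesis
  proof (intro exI[of _ M] conjI allI impI)
    fix s :: complex assume "cmod s \<le> 1"
    then have "cmod (eval_fps G s * s ^ (2 * n + 2)) \<le> M * cmod s ^ (2 * n + 2)"
      using M by (simp add: norm_mult norm_power mult_right_mono del: power_Suc)
    then show "cmod (poly (pade_den n) s * exp s - poly (pade_num n) s - fps_nth ?E ?N * s ^ ?N)
        \<le> M * cmod s ^ (2 * n + 2)"
      unfolding ev ev2 by simp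
  qed (use M in simp)
qed

section \<open>Rational interpolation at shrinking nodes\<close>

lemma norm_poly_le_sum_norm_coeff:
  fixes p :: "'a :: real_normed_field poly"
  assumes "degree p \<le> n" "norm z \<le> 1"
  shows "norm (poly p z) \<le> (\<Sum>k\<le>n. norm (coeff p k))"
proof -
  have "norm (poly p z) = norm (\<Sum>k\<le>n. coeff p k * z ^ k)"
    by (subst poly_as_sum_of_monoms'[OF assms(1), symmetric]) (simp add: poly_sum poly_monom)
  also have "\<dots> \<le> (\<Sum>k\<le>n. norm (coeff p k))"
    using assms(2) by (intro sum_norm_le) (simp add: norm_mult norm_power mult_left_le power_le_one)
  finally show ?thesis .
qed

text \<open>For \<open>D = p Q - q P\<close> the Bezout identity \<open>A P + B Q = 1\<close> gives \<open>q \<equiv> - A D\<close> modulo \<open>Q\<close>, so \<open>q\<close> is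
  determined by \<open>D\<close> up to a multiple of \<open>Q\<close> (a scalar multiple, because \<open>Q\<close> has degree \<open>n\<close>), and
  linearly: the fixed polynomials \<open>R k\<close> are the residues of \<open>- A s ^ k\<close>. A small \<open>D\<close> therefore forces
  \<open>q\<close> to be close to a multiple of \<open>Q\<close>.\<close>

lemma pade_den_recovered_from_cross_remainder:
  assumes "n \<ge> 1"
  shows "\<exists>R. \<forall>p q. degree q \<le> n \<longrightarrow> degree (p * pade_den n - q * pade_num n) \<le> 2 * n \<longrightarrow>
    (\<exists>\<gamma>. q = smult \<gamma> (pade_den n)
             + (\<Sum>k\<le>2 * n. smult (coeff (p * pade_den n - q * pade_num n) k) (R k)))"
proof -
  let ?P = "pade_num n" and ?Q = "pade_den n"
  obtain A B where AB: "A * ?P + B * ?Q = 1" using pade_bezout[OF assms] by blast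
  define R where "R k = (- A * monom 1 k) mod ?Q" for k
  define T where "T k = (- A * monom 1 k) div ?Q" for k
  have RT: "- A * monom 1 k = T k * ?Q + R k" for k
    unfolding R_def T_def by (rule div_mult_mod_eq[symmetric])
  have "?Q \<noteq> 0" using degree_pade(2)[of n] assms by auto
  then have degR: "degree (R k) \<le> n" for k
    using degree_mod_less[of ?Q "- A * monom 1 k"] by (auto simp: R_def degree_pade)
  have "\<exists>\<gamma>. q = smult \<gamma> ?Q + (\<Sum>k\<le>2 * n. smult (coeff (p * ?Q - q * ?P) k) (R k))"
    if q: "degree q \<le> n" and deg: "degree (p * ?Q - q * ?P) \<le> 2 * n" for p q
  proof -
    define D where "D = p * ?Q - q * ?P"
    define S where "S = (\<Sum>k\<le>2 * n. smult (coeff D k) (R k))"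
    have D: "D = (\<Sum>k\<le>2 * n. monom (coeff D k) k)"
      unfolding D_def by (rule poly_as_sum_of_monoms'[OF deg, symmetric])
    have "q = q * (A * ?P + B * ?Q)" by (simp add: AB)
    also have "\<dots> = - A * D + (A * p + q * B) * ?Q" by (simp add: D_def algebra_simps)
    also have "- A * D = (\<Sum>k\<le>2 * n. smult (coeff D k) (- A * monom 1 k))"
      by (subst D) (simp add: sum_distrib_left smult_monom flip: mult_smult_right)
    also have "\<dots> = (\<Sum>k\<le>2 * n. smult (coeff D k) (T k)) * ?Q + S"
      unfolding RT S_def by (simp add: smult_add_right sum.distrib sum_distrib_right)
    finally have "q = ((\<Sum>k\<le>2 * n. smult (coeff D k) (T k)) + (A * p + q * B)) * ?Q + S"
      by (simp only: distrib_right add_ac)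
    then obtain t where t: "q = t * ?Q + S" by blast
    have "degree S \<le> n"
      unfolding S_def by (intro degree_sum_le order.trans[OF degree_smult_le degR]) auto
    with q have "degree (q - S) \<le> n" by (rule degree_diff_le)
    moreover have "q - S = t * ?Q" by (subst t) simp
    ultimately have "degree (t * ?Q) \<le> n" by simp
    then have "degree t = 0"
      using degree_mult_eq[of t ?Q] \<open>?Q \<noteq> 0\<close> by (cases "t = 0") (auto simp: degree_pade)
    then obtain c where "t = [:c:]" by (auto elim: degree_eq_zeroE)
    with t show ?thesis by (intro exI[of _ c]) (simp add: S_def D_def)
  qed
  then show ?thesis by blast
qed

lemma pade_den_near_one:
  "\<exists>L>0. \<forall>s. cmod s \<le> 1 \<longrightarrow> cmod (poly (pade_den n) s - 1) \<le> L * cmod s"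
proof -
  obtain c g where cg: "pade_den n = pCons c g" by (cases "pade_den n")
  then have c: "c = 1" using coeff_pade_den[of n 0] by (simp add: pade_coeff_0)
  define L where "L = (\<Sum>k\<le>degree g. cmod (coeff g k)) + 1"
  have "L > 0" by (simp add: L_def add_nonneg_pos sum_nonneg)
  moreover have "cmod (poly (pade_den n) s - 1) \<le> L * cmod s" if "cmod s \<le> 1" for s
  proof -
    have "cmod (poly g s) \<le> L"
      using norm_poly_le_sum_norm_coeff[OF order_refl that, of g] by (simp add: L_def)
    then show ?thesis
      using mult_left_mono[of "cmod (poly g s)" L "cmod s"] by (simp add: cg c norm_mult mult.commute)
  qed
  ultimately show ?thesis by blast
qed

text \<open>Interpolating \<open>exp (\<omega> z)\<close> at the fixed nodes \<open>a\<close> is the same as interpolating \<open>exp s\<close> at the nodes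
  \<open>s = \<omega> a\<close>, which shrink to 0 together with \<open>\<omega>\<close>. The expansion of the error below holds for every
  choice of \<open>2 n + 1\<close> nodes in the unit disc.\<close>

locale shrinking_nodes =
  fixes n :: nat and A :: "complex set"
  assumes n: "n \<ge> 1" and card_A: "card A = 2 * n + 1" and A_unit: "\<And>a. a \<in> A \<Longrightarrow> cmod a \<le> 1"
begin

definition interpolates :: "real \<Rightarrow> complex poly \<Rightarrow> complex poly \<Rightarrow> bool" where
  "interpolates \<omega> p q \<longleftrightarrow> degree p \<le> n \<and> degree q \<le> n \<and> \<not> (p = 0 \<and> q = 0) \<and>
     (\<forall>a\<in>A. poly p a = exp (of_real \<omega> * a) * poly q a)"

lemma finite_A: "finite A"
  using card_A card.infinite by fastforce

lemma denominator_nonzero: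
  assumes "interpolates \<omega> p q"
  shows "q \<noteq> 0"
proof
  assume "q = 0"
  with assms have "p = 0"
    by (intro poly_eqI_degree[of A]) (auto simp: interpolates_def card_A)
  with \<open>q = 0\<close> assms show False by (simp add: interpolates_def)
qed

definition kappa :: complex (\<open>\<kappa>\<close>) where "\<kappa> = fps_nth (pade_remainder n) (2 * n + 1)"

text \<open>In the variable \<open>s = \<omega> z\<close> let \<open>N\<close> be the sum of the absolute values of the coefficients of the
  denominator. The polynomial \<open>D = p Q - q P\<close> agrees at the nodes with \<open>q\<close> times the Pade remainder and is
  therefore \<open>O(N \<omega> ^ (2 n + 1))\<close> there. Interpolation and undoing the scaling cost at most
  \<open>\<omega> ^ (2 n)\<close>, so the coefficients of \<open>D\<close> are \<open>O(N \<omega>)\<close>, and \<open>q\<close> is \<open>\<gamma> Q\<close> up to \<open>O(N \<omega>)\<close>. For small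
  \<open>\<omega>\<close> this error is absorbed in \<open>N\<close>, which shows \<open>N = O(\<bar>\<gamma>\<bar>)\<close>. Finally \<open>Q(\<omega> z) = 1 + O(\<omega>)\<close>.\<close>

lemma denominator_nearly_constant:
  "\<exists>C>0. \<exists>\<delta>>0. \<forall>\<omega> p q. 0 < \<omega> \<longrightarrow> \<omega> < \<delta> \<longrightarrow> interpolates \<omega> p q \<longrightarrow>
     (\<exists>\<gamma>. \<gamma> \<noteq> 0 \<and> (\<forall>z. cmod z \<le> 1 \<longrightarrow> cmod (poly q z - \<gamma>) \<le> C * \<omega> * cmod \<gamma>))"
proof -
  let ?P = "pade_num n" and ?Q = "pade_den n"
  obtain M where M: "M > 0" "\<And>s. cmod s \<le> 1 \<Longrightarrow>
      cmod (poly ?Q s * exp s - poly ?P s - \<kappa> * s ^ (2 * n + 1)) \<le> M * cmod s ^ (2 * n + 2)"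
    using pade_remainder_asymptotics[of n] unfolding kappa_def by blast
  define M1 where "M1 = cmod \<kappa> + M"
  have M1: "cmod (poly ?Q s * exp s - poly ?P s) \<le> M1 * cmod s ^ (2 * n + 1)" if "cmod s \<le> 1" for s
  proof -
    have "cmod (poly ?Q s * exp s - poly ?P s) \<le> cmod (\<kappa> * s ^ (2 * n + 1)) + M * cmod s ^ (2 * n + 2)"
      using M(2)[OF that] norm_triangle_sub[of "poly ?Q s * exp s - poly ?P s" "\<kappa> * s ^ (2 * n + 1)"] by linarith
    also have "\<dots> \<le> cmod \<kappa> * cmod s ^ (2 * n + 1) + M * cmod s ^ (2 * n + 1)"
      using that M(1) by (intro add_mono mult_left_mono power_decreasing) (auto simp: norm_mult norm_power)
    finally show ?thesis by (simp add: M1_def algebra_simps)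
  qed
  obtain C0 where C0: "C0 \<ge> 0" "\<And>p B k. degree p < card A \<Longrightarrow> (\<And>a. a \<in> A \<Longrightarrow> cmod (poly p a) \<le> B) \<Longrightarrow>
      cmod (coeff p k) \<le> C0 * B"
    using coeff_bounded_by_interpolated_values[OF finite_A] by blast
  obtain R where R: "\<And>p q. degree q \<le> n \<Longrightarrow> degree (p * ?Q - q * ?P) \<le> 2 * n \<Longrightarrow>
    (\<exists>\<gamma>. q = smult \<gamma> ?Q + (\<Sum>k\<le>2 * n. smult (coeff (p * ?Q - q * ?P) k) (R k)))"
    using pade_den_recovered_from_cross_remainder[OF n] by blast
  define \<rho> where "\<rho> = (\<Sum>i\<le>n. \<Sum>k\<le>2 * n. cmod (coeff (R k) i))"
  define K where "K = C0 * M1 * \<rho>"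
  define N0 where "N0 = (\<Sum>k\<le>n. cmod (coeff ?Q k))"
  have "\<rho> \<ge> 0" "M1 \<ge> 0" using M(1) by (auto simp: \<rho>_def M1_def intro!: sum_nonneg)
  then have K: "K \<ge> 0" using C0 by (simp add: K_def)
  have "N0 \<ge> 0" by (simp add: N0_def sum_nonneg)
  obtain L where L: "L > 0" "\<And>s. cmod s \<le> 1 \<Longrightarrow> cmod (poly ?Q s - 1) \<le> L * cmod s"
    using pade_den_near_one by blast
  \<comment> \<open>The bound \<open>K \<omega> \<le> 1 / 2\<close> lets \<open>K N \<omega>\<close> be absorbed in \<open>N\<close>.\<close>
  define \<delta> where "\<delta> = min 1 (1 / (2 * (K + 1)))"
  have "\<delta> > 0" using K by (simp add: \<delta>_def)
  have main: "\<exists>\<gamma>. \<gamma> \<noteq> 0 \<and> (\<forall>z. cmod z \<le> 1 \<longrightarrow> cmod (poly q z - \<gamma>) \<le> (2 * K * N0 + L) * \<omega> * cmod \<gamma>)"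
    if \<omega>: "0 < \<omega>" "\<omega> < \<delta>" and pq: "interpolates \<omega> p q" for \<omega> p q
  proof -
    have \<omega>1: "\<omega> \<le> 1" "K * \<omega> \<le> 1 / 2"
    proof -
      have "\<omega> * (2 * (K + 1)) < 1" using \<omega> K by (simp add: \<delta>_def field_simps)
      then show "K * \<omega> \<le> 1 / 2" using \<omega> by (simp add: algebra_simps)
    qed (use \<omega> in \<open>simp add: \<delta>_def\<close>)
    define p' where "p' = pcompose p [:0, 1 / of_real \<omega>:]"
    define q' where "q' = pcompose q [:0, 1 / of_real \<omega>:]"
    have p': "poly p' (of_real \<omega> * z) = poly p z" and q': "poly q' (of_real \<omega> * z) = poly q z" for z
      using \<omega> by (simp_all add: p'_def q'_def poly_pcompose)
    have deg: "degree p' \<le> n" "degree q' \<le> n"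
      using pq degree_pcompose_le[of p "[:0, 1 / of_real \<omega>:]"] degree_pcompose_le[of q "[:0, 1 / of_real \<omega>:]"] \<omega>
      by (auto simp: p'_def q'_def interpolates_def)
    define D where "D = p' * ?Q - q' * ?P"
    have degD: "degree D \<le> 2 * n"
      unfolding D_def using deg degree_mult_le[of p' ?Q] degree_mult_le[of q' ?P]
      by (intro degree_diff_le) (auto simp: degree_pade)
    define N where "N = (\<Sum>k\<le>n. cmod (coeff q' k))"
    have N: "N \<ge> 0" by (simp add: N_def sum_nonneg)
    have small: "cmod (of_real \<omega> * z) \<le> \<omega>" "cmod (of_real \<omega> * z) \<le> 1" if "cmod z \<le> 1" for z
    proof -
      show *: "cmod (of_real \<omega> * z) \<le> \<omega>"
        using that \<omega> mult_left_mono[of "cmod z" 1 \<omega>] by (simp add: norm_mult)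
      show "cmod (of_real \<omega> * z) \<le> 1" using * \<omega>1(1) by linarith
    qed
    have DA: "cmod (poly (pcompose D [:0, of_real \<omega>:]) a) \<le> N * (M1 * \<omega> ^ (2 * n + 1))" if a: "a \<in> A" for a
    proof -
      let ?s = "of_real \<omega> * a"
      have s: "cmod ?s \<le> \<omega>" "cmod ?s \<le> 1" using small[OF A_unit[OF a]] by auto
      have "poly p a = exp ?s * poly q a" using pq a by (simp add: interpolates_def)
      then have "poly (pcompose D [:0, of_real \<omega>:]) a = poly q' ?s * (poly ?Q ?s * exp ?s - poly ?P ?s)"
        using p'[of a] q'[of a] by (simp add: poly_pcompose D_def algebra_simps)
      moreover have "cmod (poly q' ?s) \<le> N"
        unfolding N_def by (rule norm_poly_le_sum_norm_coeff[OF deg(2) s(2)])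
      moreover have "cmod (poly ?Q ?s * exp ?s - poly ?P ?s) \<le> M1 * \<omega> ^ (2 * n + 1)"
        using M1[OF s(2)] power_mono[OF s(1), of "2 * n + 1"] \<open>M1 \<ge> 0\<close>
        by (meson mult_left_mono norm_ge_zero order.trans)
      ultimately show ?thesis using N by (simp add: norm_mult mult_mono)
    qed
    have coeffD: "cmod (coeff D k) \<le> C0 * M1 * N * \<omega>" if k: "k \<le> 2 * n" for k
    proof -
      have "degree (pcompose D [:0, of_real \<omega>:]) \<le> 2 * n"
        using degree_pcompose_le[of D "[:0, of_real \<omega>:]"] degD \<omega> by auto
      then have "cmod (coeff (pcompose D [:0, of_real \<omega>:]) k) \<le> C0 * (N * (M1 * \<omega> ^ (2 * n + 1)))"
        by (intro C0(2)[OF _ DA]) (auto simp: card_A)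
      also have "coeff (pcompose D [:0, of_real \<omega>:]) k = of_real \<omega> ^ k * coeff D k"
        by (simp add: coeff_pcompose_linear)
      finally have "\<omega> ^ k * cmod (coeff D k) \<le> C0 * (N * (M1 * \<omega> ^ (2 * n + 1)))"
        using \<omega> by (simp add: norm_mult norm_power)
      \<comment> \<open>One power of \<open>\<omega>\<close> survives because \<open>D\<close> has degree at most \<open>2 n\<close>.\<close>
      also have "\<dots> \<le> C0 * (N * (M1 * \<omega> ^ (k + 1)))"
        using k \<omega> \<omega>1 C0 N \<open>M1 \<ge> 0\<close> by (intro mult_left_mono power_decreasing) auto
      also have "\<dots> = \<omega> ^ k * (C0 * M1 * N * \<omega>)" by simp
      finally show ?thesis using \<omega> by simp
    qed
    obtain \<gamma> where \<gamma>: "q' = smult \<gamma> ?Q + (\<Sum>k\<le>2 * n. smult (coeff D k) (R k))"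
      using R[OF deg(2), of p'] degD unfolding D_def by blast
    have diff: "(\<Sum>i\<le>n. cmod (coeff (q' - smult \<gamma> ?Q) i)) \<le> K * N * \<omega>"
    proof -
      have "cmod (coeff (q' - smult \<gamma> ?Q) i) \<le> (\<Sum>k\<le>2 * n. cmod (coeff (R k) i)) * (C0 * M1 * N * \<omega>)" for i
      proof -
        have "cmod (coeff (q' - smult \<gamma> ?Q) i) = cmod (\<Sum>k\<le>2 * n. coeff D k * coeff (R k) i)"
          by (subst \<gamma>) (simp add: coeff_sum)
        also have "\<dots> \<le> (\<Sum>k\<le>2 * n. cmod (coeff (R k) i) * (C0 * M1 * N * \<omega>))"
        proof (rule sum_norm_le)
          fix k assume "k \<in> {..2 * n}"
          then show "cmod (coeff D k * coeff (R k) i) \<le> cmod (coeff (R k) i) * (C0 * M1 * N * \<omega>)"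
            using mult_right_mono[OF coeffD[of k], of "cmod (coeff (R k) i)"]
            by (simp add: norm_mult mult.commute)
        qed
        finally show ?thesis by (simp add: sum_distrib_right)
      qed
      then have "(\<Sum>i\<le>n. cmod (coeff (q' - smult \<gamma> ?Q) i)) \<le> \<rho> * (C0 * M1 * N * \<omega>)"
        unfolding \<rho>_def sum_distrib_right[of _ "{..n}"] by (intro sum_mono)
      then show ?thesis by (simp add: K_def mult_ac)
    qed
    have N_le: "N \<le> 2 * cmod \<gamma> * N0"
    proof -
      have "N \<le> (\<Sum>i\<le>n. cmod (coeff (q' - smult \<gamma> ?Q) i) + cmod \<gamma> * cmod (coeff ?Q i))"
        unfolding N_def
      proof (rule sum_mono)
        fix i show "cmod (coeff q' i) \<le> cmod (coeff (q' - smult \<gamma> ?Q) i) + cmod \<gamma> * cmod (coeff ?Q i)"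
          using norm_triangle_sub[of "coeff q' i" "\<gamma> * coeff ?Q i"] by (simp add: norm_mult)
      qed
      also have "\<dots> \<le> K * N * \<omega> + cmod \<gamma> * N0"
        using diff by (simp add: sum.distrib N0_def sum_distrib_left)
      also have "K * N * \<omega> \<le> 1 / 2 * N" using mult_right_mono[OF \<omega>1(2) N] by (simp add: mult_ac)
      finally show ?thesis by simp
    qed
    have "\<gamma> \<noteq> 0"
    proof
      assume "\<gamma> = 0"
      with N_le N have "N = 0" by simp
      then have "\<forall>k\<le>n. coeff q' k = 0" by (simp add: N_def sum_nonneg_eq_0_iff)
      with deg(2) have "q' = 0" by (metis leading_coeff_0_iff)
      then have "poly q z = 0" for z using q'[of z] by simp
      then have "q = 0" using poly_all_0_iff_0 by blast
      with denominator_nonzero[OF pq] show False by simp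
    qed
    moreover have "cmod (poly q z - \<gamma>) \<le> (2 * K * N0 + L) * \<omega> * cmod \<gamma>" if z: "cmod z \<le> 1" for z
    proof -
      let ?s = "of_real \<omega> * z"
      note s = small[OF z]
      have "degree (q' - smult \<gamma> ?Q) \<le> n"
        using deg by (intro degree_diff_le order.trans[OF degree_smult_le]) (auto simp: degree_pade)
      from norm_poly_le_sum_norm_coeff[OF this s(2)] diff
      have 1: "cmod (poly q' ?s - \<gamma> * poly ?Q ?s) \<le> K * N * \<omega>" by simp
      have "cmod \<gamma> * cmod (poly ?Q ?s - 1) \<le> cmod \<gamma> * (L * \<omega>)"
        using L(2)[OF s(2)] s(1) L(1) by (intro mult_left_mono) (auto intro: order.trans)
      moreover have "\<gamma> * poly ?Q ?s - \<gamma> = \<gamma> * (poly ?Q ?s - 1)" by (simp add: algebra_simps)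
      ultimately have 2: "cmod (\<gamma> * poly ?Q ?s - \<gamma>) \<le> cmod \<gamma> * (L * \<omega>)"
        by (simp only: norm_mult)
      have "cmod (poly q z - \<gamma>) \<le> K * N * \<omega> + cmod \<gamma> * (L * \<omega>)"
        using norm_triangle_mono[OF 1 2] by (simp add: q')
      also have "K * N * \<omega> \<le> K * (2 * cmod \<gamma> * N0) * \<omega>"
        using N_le K \<omega> by (intro mult_right_mono mult_left_mono) auto
      finally show ?thesis by (simp add: algebra_simps)
    qed
    ultimately show ?thesis by blast
  qed
  show ?thesis
  proof (rule exI[of _ "2 * K * N0 + L"], intro conjI)
    show "2 * K * N0 + L > 0" using K \<open>N0 \<ge> 0\<close> L(1) by (simp add: add_nonneg_pos)
    show "\<exists>\<delta>>0. \<forall>\<omega> p q. 0 < \<omega> \<longrightarrow> \<omega> < \<delta> \<longrightarrow> interpolates \<omega> p q \<longrightarrow>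
     (\<exists>\<gamma>. \<gamma> \<noteq> 0 \<and> (\<forall>z. cmod z \<le> 1 \<longrightarrow> cmod (poly q z - \<gamma>) \<le> (2 * K * N0 + L) * \<omega> * cmod \<gamma>))"
      using main \<open>\<delta> > 0\<close> by blast
  qed
qed

text \<open>Normalise the denominator so that \<open>q = 1 + O(\<omega>)\<close>, and let \<open>f z = q z E (\<omega> z)\<close> with \<open>E\<close> the Pade
  remainder. At the nodes \<open>f\<close> coincides with \<open>D = p Q - q P\<close> (\<open>P\<close> and \<open>Q\<close> evaluated at \<open>\<omega> z\<close>), which has
  degree at most \<open>2 n\<close>, so \<open>D\<close> is the interpolation polynomial of \<open>f\<close>. As
  \<open>f z = \<kappa> \<omega> ^ (2 n + 1) z ^ (2 n + 1) + O(\<omega> ^ (2 n + 2))\<close>, and the interpolation error of the power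
  \<open>z ^ (2 n + 1)\<close> is exactly the node polynomial \<open>W\<close>, boundedness of interpolation yields
  \<open>f - D = \<kappa> \<omega> ^ (2 n + 1) W + O(\<omega> ^ (2 n + 2))\<close>. The claim follows from the identity
  \<open>exp (\<omega> z) - p / q = (f - D) / (q Q)\<close>, whose denominator is \<open>1 + O(\<omega>)\<close>.\<close>

lemma interpolation_error_expansion:
  "\<exists>C \<delta>. \<delta> > 0 \<and> (\<forall>\<omega> p q. 0 < \<omega> \<longrightarrow> \<omega> < \<delta> \<longrightarrow> interpolates \<omega> p q \<longrightarrow>
     (\<forall>z. cmod z \<le> 1 \<longrightarrow> poly q z \<noteq> 0 \<and>
        cmod (exp (of_real \<omega> * z) - poly p z / poly q z - \<kappa> * of_real \<omega> ^ (2 * n + 1) * (\<Prod>a\<in>A. z - a))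
          \<le> C * \<omega> ^ (2 * n + 2)))"
proof -
  let ?P = "pade_num n" and ?Q = "pade_den n" and ?N = "2 * n + 1"
  obtain M where M: "M > 0" "\<And>s. cmod s \<le> 1 \<Longrightarrow>
      cmod (poly ?Q s * exp s - poly ?P s - \<kappa> * s ^ ?N) \<le> M * cmod s ^ (2 * n + 2)"
    using pade_remainder_asymptotics[of n] unfolding kappa_def by blast
  obtain C1 \<delta>1 where C1: "C1 > 0" "\<delta>1 > 0" "\<And>\<omega> p q. 0 < \<omega> \<Longrightarrow> \<omega> < \<delta>1 \<Longrightarrow> interpolates \<omega> p q \<Longrightarrow>
     (\<exists>\<gamma>. \<gamma> \<noteq> 0 \<and> (\<forall>z. cmod z \<le> 1 \<longrightarrow> cmod (poly q z - \<gamma>) \<le> C1 * \<omega> * cmod \<gamma>))"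
    using denominator_nearly_constant by metis
  obtain L where L: "L > 0" "\<And>s. cmod s \<le> 1 \<Longrightarrow> cmod (poly ?Q s - 1) \<le> L * cmod s"
    using pade_den_near_one by blast
  obtain C0 where C0: "C0 \<ge> 0" "\<And>p B k. degree p < card A \<Longrightarrow> (\<And>a. a \<in> A \<Longrightarrow> cmod (poly p a) \<le> B) \<Longrightarrow>
      cmod (coeff p k) \<le> C0 * B"
    using coeff_bounded_by_interpolated_values[OF finite_A] by blast
  define C2 where "C2 = 2 * M + C1 * cmod \<kappa>"
  define C3 where "C3 = C2 + real ?N * (C0 * C2)"
  define C4 where "C4 = 2 * L + C1"
  define C where "C = 2 * (C3 + C4 * (cmod \<kappa> * 2 ^ ?N))"
  define \<delta> where "\<delta> = Min {1, \<delta>1, 1 / (2 * C4)}"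
  have pos: "C2 \<ge> 0" "C4 > 0" using M(1) C1(1) L(1) by (auto simp: C2_def C4_def intro: add_pos_pos)
  have "\<delta> > 0" using C1(2) pos by (simp add: \<delta>_def)
  define W where "W = (\<Prod>a\<in>A. [:- a, 1:])"
  have W: "poly W z = (\<Prod>a\<in>A. z - a)" for z by (simp add: W_def poly_prod)
  have W_le: "cmod (poly W z) \<le> 2 ^ ?N" if "cmod z \<le> 1" for z
  proof -
    have "cmod (poly W z) = (\<Prod>a\<in>A. cmod (z - a))" by (simp add: W prod_norm)
    also have "\<dots> \<le> (\<Prod>a\<in>A. 2)"
    proof (intro prod_mono conjI)
      fix a assume "a \<in> A"
      show "cmod (z - a) \<le> 2" using norm_triangle_ineq4[of z a] that A_unit[OF \<open>a \<in> A\<close>] by simp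
    qed simp
    finally show ?thesis by (simp add: card_A)
  qed
  have degW: "degree W = ?N" by (simp add: W_def degree_prod_eq_sum_degree card_A)
  have "lead_coeff W = 1" unfolding W_def lead_coeff_prod by simp
  with degW have degV: "degree (monom 1 ?N - W) \<le> 2 * n"
    by (intro degree_le) (auto simp: coeff_eq_0 less_Suc_eq_le le_less intro!: order.trans[OF degree_monom_le])
  have main: "poly q z \<noteq> 0 \<and>
        cmod (exp (of_real \<omega> * z) - poly p z / poly q z - \<kappa> * of_real \<omega> ^ ?N * (\<Prod>a\<in>A. z - a))
          \<le> C * \<omega> ^ (2 * n + 2)"
    if \<omega>: "0 < \<omega>" "\<omega> < \<delta>" and pq: "interpolates \<omega> p q" and z: "cmod z \<le> 1" for \<omega> p q z
  proof -
    have \<omega>': "\<omega> \<le> 1" "\<omega> < \<delta>1" "C4 * \<omega> \<le> 1 / 2" using \<omega> pos by (auto simp: \<delta>_def field_simps)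
    have \<omega>3: "C1 * \<omega> \<le> 1 / 2" 
    proof -
      have "0 \<le> 2 * L * \<omega>" using L(1) \<omega> by simp
      then show ?thesis using \<omega>'(3) unfolding C4_def distrib_right by linarith
    qed
    obtain \<gamma> where \<gamma>: "\<gamma> \<noteq> 0" "\<And>z. cmod z \<le> 1 \<Longrightarrow> cmod (poly q z - \<gamma>) \<le> C1 * \<omega> * cmod \<gamma>"
      using C1(3)[OF \<omega>(1) \<omega>'(2) pq] by blast
    define p1 where "p1 = smult (1 / \<gamma>) p"
    define q1 where "q1 = smult (1 / \<gamma>) q"
    have q1_near: "cmod (poly q1 z - 1) \<le> C1 * \<omega>" if "cmod z \<le> 1" for z
    proof -
      have "cmod (poly q1 z - 1) = cmod (poly q z - \<gamma>) / cmod \<gamma>"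
        using \<gamma>(1) by (simp add: q1_def diff_divide_distrib flip: norm_divide)
      then show ?thesis using \<gamma>(1) \<gamma>(2)[OF that] by (simp add: divide_le_eq)
    qed
    have q1_bounds: "cmod (poly q1 z) \<le> 2" "poly q1 z \<noteq> 0" if "cmod z \<le> 1" for z
    proof -
      have *: "cmod (poly q1 z - 1) \<le> 1 / 2" using q1_near[OF that] \<omega>3 by linarith
      then show "cmod (poly q1 z) \<le> 2" using norm_triangle_sub[of "poly q1 z" 1] by simp
      show "poly q1 z \<noteq> 0" using * by auto
    qed
    have small: "cmod (of_real \<omega> * z) \<le> \<omega>" "cmod (of_real \<omega> * z) \<le> 1" if "cmod z \<le> 1" for z
    proof -
      show *: "cmod (of_real \<omega> * z) \<le> \<omega>"
        using that \<omega> mult_left_mono[of "cmod z" 1 \<omega>] by (simp add: norm_mult)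
      show "cmod (of_real \<omega> * z) \<le> 1" using * \<omega>'(1) by linarith
    qed
    define f where "f z = poly q1 z * (poly ?Q (of_real \<omega> * z) * exp (of_real \<omega> * z) - poly ?P (of_real \<omega> * z))" for z
    have f_lead: "cmod (f z - \<kappa> * of_real \<omega> ^ ?N * z ^ ?N) \<le> C2 * \<omega> ^ (2 * n + 2)" if z: "cmod z \<le> 1" for z
    proof -
      let ?s = "of_real \<omega> * z"
      let ?E = "poly ?Q ?s * exp ?s - poly ?P ?s"
      have "cmod (?E - \<kappa> * ?s ^ ?N) \<le> M * \<omega> ^ (2 * n + 2)"
        using M(2)[OF small(2)[OF z]] power_mono[OF small(1)[OF z], of "2 * n + 2"] M(1)
        by (meson less_imp_le mult_left_mono norm_ge_zero order.trans)
      then have 1: "cmod (poly q1 z * (?E - \<kappa> * ?s ^ ?N)) \<le> 2 * (M * \<omega> ^ (2 * n + 2))"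
        unfolding norm_mult[of "poly q1 z"] by (intro mult_mono q1_bounds z) auto
      have "cmod (\<kappa> * ?s ^ ?N) \<le> cmod \<kappa> * \<omega> ^ ?N"
        unfolding norm_mult[of \<kappa>] norm_power by (intro mult_left_mono power_mono small z) auto
      then have "cmod ((poly q1 z - 1) * (\<kappa> * ?s ^ ?N)) \<le> (C1 * \<omega>) * (cmod \<kappa> * \<omega> ^ ?N)"
        unfolding norm_mult[of "poly q1 z - 1"] using C1(1) \<omega> by (intro mult_mono q1_near z) auto
      with 1 have "cmod (poly q1 z * (?E - \<kappa> * ?s ^ ?N) + (poly q1 z - 1) * (\<kappa> * ?s ^ ?N))
          \<le> 2 * (M * \<omega> ^ (2 * n + 2)) + (C1 * \<omega>) * (cmod \<kappa> * \<omega> ^ ?N)"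
        by (rule norm_triangle_mono)
      also have "poly q1 z * (?E - \<kappa> * ?s ^ ?N) + (poly q1 z - 1) * (\<kappa> * ?s ^ ?N) = f z - \<kappa> * of_real \<omega> ^ ?N * z ^ ?N"
        unfolding f_def power_mult_distrib by (simp add: algebra_simps del: power_Suc power_Suc2)
      also have "2 * (M * \<omega> ^ (2 * n + 2)) + (C1 * \<omega>) * (cmod \<kappa> * \<omega> ^ ?N) = C2 * \<omega> ^ (2 * n + 2)"
        by (simp add: C2_def algebra_simps)
      finally show ?thesis .
    qed
    define D where "D = p1 * pcompose ?Q [:0, of_real \<omega>:] - q1 * pcompose ?P [:0, of_real \<omega>:]"
    have degD: "degree D \<le> 2 * n"
    proof -
      have "degree p1 \<le> n" "degree q1 \<le> n"
        using pq by (auto simp: p1_def q1_def interpolates_def)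
      moreover have "degree (pcompose ?Q [:0, of_real \<omega>:]) \<le> n" "degree (pcompose ?P [:0, of_real \<omega>:]) \<le> n"
        using \<omega> by (simp_all add: degree_pcompose degree_pade)
      ultimately show ?thesis unfolding D_def
        by (intro degree_diff_le order.trans[OF degree_mult_le]) linarith+
    qed
    have fD: "f z - poly D z = poly ?Q (of_real \<omega> * z) * (poly q1 z * exp (of_real \<omega> * z) - poly p1 z)" for z
      by (simp add: f_def D_def poly_pcompose algebra_simps)
    \<comment> \<open>\<open>U\<close> interpolates what remains of \<open>f\<close> after removing its leading term: the polynomial
      \<open>z ^ (2 n + 1) - W\<close> has degree at most \<open>2 n\<close> and equals \<open>z ^ (2 n + 1)\<close> at the nodes.\<close>
    define U where "U = D - smult (\<kappa> * of_real \<omega> ^ ?N) (monom 1 ?N - W)"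
    have degU: "degree U \<le> 2 * n"
      unfolding U_def by (intro degree_diff_le degD order.trans[OF degree_smult_le degV])
    have UA: "cmod (poly U a) \<le> C2 * \<omega> ^ (2 * n + 2)" if a: "a \<in> A" for a
    proof -
      have "poly p a = exp (of_real \<omega> * a) * poly q a" using pq a by (simp add: interpolates_def)
      then have "poly D a = f a" using fD[of a] by (simp add: p1_def q1_def)
      moreover have "poly W a = 0" using a finite_A by (auto simp: W)
      ultimately have "poly U a = f a - \<kappa> * of_real \<omega> ^ ?N * a ^ ?N"
        by (simp add: U_def poly_monom)
      then show ?thesis using f_lead[OF A_unit[OF a]] by simp
    qed
    have "cmod (poly U z) \<le> (\<Sum>k\<le>2 * n. cmod (coeff U k))"
      by (rule norm_poly_le_sum_norm_coeff[OF degU z])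
    also have "\<dots> \<le> (\<Sum>k\<le>2 * n. C0 * (C2 * \<omega> ^ (2 * n + 2)))"
      using degU by (intro sum_mono C0(2) UA) (auto simp: card_A)
    finally have U_le: "cmod (poly U z) \<le> real ?N * (C0 * C2) * \<omega> ^ (2 * n + 2)" by simp
    define T where "T = \<kappa> * of_real \<omega> ^ ?N * poly W z"
    have "f z - poly D z - T = (f z - \<kappa> * of_real \<omega> ^ ?N * z ^ ?N) - poly U z"
      by (simp add: U_def T_def poly_monom algebra_simps)
    also have "cmod \<dots> \<le> C2 * \<omega> ^ (2 * n + 2) + real ?N * (C0 * C2) * \<omega> ^ (2 * n + 2)"
      using norm_triangle_ineq4 f_lead[OF z] U_le by (meson add_mono order.trans)
    finally have num: "cmod (f z - poly D z - T) \<le> C3 * \<omega> ^ (2 * n + 2)"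
      by (simp add: C3_def distrib_right)
    define d where "d = poly q1 z * poly ?Q (of_real \<omega> * z)"
    have d_near: "cmod (1 - d) \<le> C4 * \<omega>"
    proof -
      have "cmod (poly ?Q (of_real \<omega> * z) - 1) \<le> L * \<omega>"
        using L(2)[OF small(2)[OF z]] small(1)[OF z] L(1) by (meson less_imp_le mult_left_mono order.trans)
      then have "cmod (poly q1 z * (poly ?Q (of_real \<omega> * z) - 1)) \<le> 2 * (L * \<omega>)"
        unfolding norm_mult by (intro mult_mono q1_bounds z) auto
      from norm_triangle_mono[OF this q1_near[OF z]]
      have "cmod (d - 1) \<le> 2 * (L * \<omega>) + C1 * \<omega>" by (simp add: d_def algebra_simps)
      then show ?thesis by (simp add: C4_def algebra_simps norm_minus_commute)
    qed
    have d_ge: "cmod d \<ge> 1 / 2"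
      using d_near \<omega>'(3) norm_triangle_sub[of 1 d] by simp
    then have "d \<noteq> 0" by auto
    have "cmod T \<le> cmod \<kappa> * \<omega> ^ ?N * 2 ^ ?N"
      unfolding T_def norm_mult norm_power using \<omega> W_le[OF z] by (intro mult_mono) auto
    then have "cmod (T * (1 - d)) \<le> (cmod \<kappa> * \<omega> ^ ?N * 2 ^ ?N) * (C4 * \<omega>)"
      unfolding norm_mult[of T] using d_near \<omega> by (intro mult_mono) auto
    from norm_triangle_mono[OF num this]
    have num': "cmod (f z - poly D z - d * T) \<le> C / 2 * \<omega> ^ (2 * n + 2)"
      by (simp add: C_def algebra_simps)
    have qz: "poly q z = \<gamma> * poly q1 z" "poly p z = \<gamma> * poly p1 z" using \<gamma>(1) by (simp_all add: q1_def p1_def)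
    have Qnz: "poly ?Q (of_real \<omega> * z) \<noteq> 0" using \<open>d \<noteq> 0\<close> by (auto simp: d_def)
    have "exp (of_real \<omega> * z) - poly p z / poly q z - T = (f z - poly D z - d * T) / d"
      using Qnz q1_bounds(2)[OF z] \<gamma>(1) unfolding fD d_def qz by (simp add: field_simps)
    also have "cmod \<dots> \<le> (C / 2 * \<omega> ^ (2 * n + 2)) / (1 / 2)"
      unfolding norm_divide by (intro frac_le num' d_ge order.trans[OF norm_ge_zero num']) simp
    finally show ?thesis using qz \<gamma>(1) q1_bounds(2)[OF z] by (simp add: T_def W)
  qed
  then show ?thesis using \<open>\<delta> > 0\<close> by blast
qed

end

section \<open>Chebyshev nodes\<close>

fun cheb_poly :: "nat \<Rightarrow> real poly" where
  "cheb_poly 0 = 1"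
| "cheb_poly (Suc 0) = [:0, 1:]"
| "cheb_poly (Suc (Suc n)) = [:0, 2:] * cheb_poly (Suc n) - cheb_poly n"

lemma poly_cheb_poly_cos: "poly (cheb_poly n) (cos t) = cos (real n * t)"
proof (induction n rule: cheb_poly.induct)
  case (3 n)
  have "cos (real (Suc (Suc n)) * t) + cos (real n * t) = 2 * cos t * cos (real (Suc n) * t)"
    using cos_plus_cos[of "real (Suc (Suc n)) * t" "real n * t"] by (simp add: algebra_simps add_divide_distrib)
  with 3 show ?case by (simp add: mult.assoc)
qed simp_all

lemma degree_cheb_poly: "degree (cheb_poly n) \<le> n"
  by (induction n rule: cheb_poly.induct)
     (auto intro!: degree_diff_le order.trans[OF degree_pCons_le] order.trans[OF degree_smult_le])

lemma coeff_cheb_poly: "coeff (cheb_poly (Suc n)) (Suc n) = 2 ^ n"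
proof (induction n rule: induct_nat_012)
  case (ge2 n)
  have "coeff (cheb_poly (Suc n)) (Suc (Suc (Suc n))) = 0"
    using degree_cheb_poly[of "Suc n"] by (intro coeff_eq_0) simp
  with ge2 show ?case by simp
qed (simp_all add: numeral_2_eq_2)

text \<open>The angles lie in the interval \<open>[0, \<pi>]\<close>, on which cosine is injective; this makes the nodes distinct.\<close>

lemma chebyshev_node_arg:
  assumes "j \<in> {1..2 * n + 1}"
  shows "(2 * real j - 1) * pi / (2 * (2 * real n + 1)) \<in> {0..pi}"
proof -
  have "real j \<le> real (2 * n + 1)" using assms by (simp only: of_nat_le_iff) simp
  then have j: "0 \<le> 2 * real j - 1" "2 * real j - 1 \<le> 2 * (2 * real n + 1)"
    using assms by auto
  then show ?thesis
    using mult_right_mono[OF j(2), of pi] by (simp add: divide_le_eq mult.commute)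
qed

lemma inj_chebyshev_node: "inj_on (chebyshev_node n) {1..2 * n + 1}"
proof (rule inj_onI)
  fix i j assume ij: "i \<in> {1..2 * n + 1}" "j \<in> {1..2 * n + 1}" "chebyshev_node n i = chebyshev_node n j"
  define t where "t k = (2 * real k - 1) * pi / (2 * (2 * real n + 1))" for k
  have "cos (t i) = cos (t j)" using ij(3) unfolding chebyshev_node_def t_def .
  moreover have "t i \<in> {0..pi}" "t j \<in> {0..pi}"
    unfolding t_def by (rule chebyshev_node_arg[OF ij(1)], rule chebyshev_node_arg[OF ij(2)])
  ultimately have "t i = t j" by (auto intro: cos_inj_pi)
  moreover have "2 * (2 * real n + 1) > 0" by (intro mult_pos_pos add_nonneg_pos) simp_all
  ultimately have "(2 * real i - 1) * pi = (2 * real j - 1) * pi"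
    unfolding t_def divide_cancel_right by (elim disjE) simp_all
  then show "i = j" by simp
qed

lemma cheb_poly_chebyshev_node: "poly (cheb_poly (2 * n + 1)) (chebyshev_node n j) = 0"
proof -
  have "real (2 * n + 1) * ((2 * real j - 1) * pi / (2 * (2 * real n + 1))) = real j * pi - pi / 2"
  proof -
    have "2 * real n + 1 \<noteq> 0" by linarith
    then show ?thesis by (simp add: field_simps)
  qed
  then show ?thesis
    unfolding chebyshev_node_def poly_cheb_poly_cos by (simp add: cos_diff)
qed

text \<open>The Chebyshev polynomial of degree \<open>2 n + 1\<close> vanishes at the nodes and has leading coefficient
  \<open>4 ^ n\<close>. Its monic multiple differs from the node polynomial by a polynomial of degree at most \<open>2 n\<close>
  with \<open>2 n + 1\<close> zeros.\<close>

lemma chebyshev_node_polynomial: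
  "(\<Prod>j\<in>{1..2 * n + 1}. x - chebyshev_node n j) = poly (cheb_poly (2 * n + 1)) x / 4 ^ n"
proof -
  define J where "J = {1..2 * n + 1}"
  have J: "finite J" "card J = 2 * n + 1" "inj_on (chebyshev_node n) J"
    using inj_chebyshev_node[of n] by (simp_all add: J_def)
  let ?W = "\<Prod>j\<in>J. [:- chebyshev_node n j, 1:]" and ?T = "smult (1 / 4 ^ n) (cheb_poly (2 * n + 1))"
  have degW: "degree ?W = 2 * n + 1" by (simp add: degree_prod_eq_sum_degree J)
  have "lead_coeff ?W = 1" unfolding lead_coeff_prod by simp
  with degW have W: "degree ?W = 2 * n + 1" "coeff ?W (2 * n + 1) = 1" by simp_all
  have T: "coeff ?T (2 * n + 1) = 1" by (simp add: coeff_cheb_poly power_mult del: cheb_poly.simps)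
  define X where "X = ?W - ?T"
  have "X = 0"
  proof (rule poly_eqI_degree[of "chebyshev_node n ` J"])
    have "degree X \<le> 2 * n + 1"
      unfolding X_def using W(1) degree_cheb_poly[of "2 * n + 1"]
      by (intro degree_diff_le order.trans[OF degree_smult_le]) simp_all
    moreover have "degree X \<noteq> 2 * n + 1"
    proof
      assume deg: "degree X = 2 * n + 1"
      have "coeff X (2 * n + 1) = 0" unfolding X_def coeff_diff W(2) T by simp
      then have "X = 0" unfolding deg[symmetric] leading_coeff_0_iff .
      with deg show False by simp
    qed
    ultimately show "degree X < card (chebyshev_node n ` J)"
      by (simp add: card_image J)
    fix x assume "x \<in> chebyshev_node n ` J"
    then obtain j where j: "j \<in> J" "x = chebyshev_node n j" by blast
    then have "(\<Prod>i\<in>J. x - chebyshev_node n i) = 0" using J(1) by (intro prod_zero) auto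
    then show "poly X x = poly 0 x"
      using cheb_poly_chebyshev_node[of n j] by (simp add: X_def poly_prod j(2) del: cheb_poly.simps)
  qed (simp add: card_image J)
  then have "poly ?W x = poly ?T x" by (simp add: X_def)
  then show ?thesis unfolding J_def[symmetric] by (simp add: poly_prod del: cheb_poly.simps)
qed

lemma SUP_scaled_abs_cheb_poly:
  assumes "c \<ge> 0"
  shows "(SUP x\<in>{-1..1}. c * \<bar>poly (cheb_poly n) x\<bar>) = c"
proof (rule cSup_eq_maximum)
  show "c \<in> (\<lambda>x. c * \<bar>poly (cheb_poly n) x\<bar>) ` {-1..1}"
    using poly_cheb_poly_cos[of n 0] by (intro image_eqI[of _ _ 1]) simp_all
  fix y assume "y \<in> (\<lambda>x. c * \<bar>poly (cheb_poly n) x\<bar>) ` {-1..1}"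
  then obtain x where x: "x \<in> {-1..1}" "y = c * \<bar>poly (cheb_poly n) x\<bar>" by blast
  then have "\<bar>poly (cheb_poly n) x\<bar> \<le> 1" using poly_cheb_poly_cos[of n "arccos x"] by simp
  then show "y \<le> c" using assms by (simp add: x(2) mult_left_le)
qed

text \<open>This transfers an expansion of the error that is uniform on the interval to its supremum.\<close>

lemma abs_SUP_diff_le:
  fixes f g :: "'a \<Rightarrow> real"
  assumes "S \<noteq> {}" "bdd_above (g ` S)" "\<And>x. x \<in> S \<Longrightarrow> \<bar>f x - g x\<bar> \<le> \<epsilon>"
  shows "\<bar>(SUP x\<in>S. f x) - (SUP x\<in>S. g x)\<bar> \<le> \<epsilon>"
proof -
  have le: "f x \<le> g x + \<epsilon>" "g x \<le> f x + \<epsilon>" if "x \<in> S" for x using assms(3)[OF that] by auto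
  obtain b where b: "\<And>x. x \<in> S \<Longrightarrow> g x \<le> b" using assms(2) by (auto simp: bdd_above_def)
  have bf: "bdd_above (f ` S)"
    by (rule bdd_aboveI2[of _ _ "b + \<epsilon>"]) (use b le in fastforce)
  have "(SUP x\<in>S. f x) \<le> (SUP x\<in>S. g x) + \<epsilon>"
    using le(1) cSUP_upper[OF _ assms(2)] by (intro cSUP_least[OF assms(1)]) (meson add_right_mono order.trans)
  moreover have "(SUP x\<in>S. g x) \<le> (SUP x\<in>S. f x) + \<epsilon>"
    using le(2) cSUP_upper[OF _ bf] by (intro cSUP_least[OF assms(1)]) (meson add_right_mono order.trans)
  ultimately show ?thesis by linarith
qed

section \<open>The error at Chebyshev nodes\<close>

theorem proposition8p3:
  fixes n :: nat
  assumes "n \<ge> 1"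
  shows "(\<lambda>\<omega>::real. approx_error (rational_interpolant n (chebyshev_node n) \<omega>) \<omega>
            - 2 * (fact n)^2 / (fact (2 * n) * fact (2 * n + 1)) * (\<omega> / 2) ^ (2 * n + 1))
         \<in> O[at_right 0](\<lambda>\<omega>. \<omega> ^ (2 * n + 2))"
proof -
  let ?N = "2 * n + 1"
  define J where "J = {1..2 * n + 1}"
  define node :: "nat \<Rightarrow> complex" where "node j = \<i> * of_real (chebyshev_node n j)" for j
  define A where "A = node ` J"
  have J: "finite J" "card J = ?N" by (simp_all add: J_def)
  have inj: "inj_on node J"
    using inj_chebyshev_node[of n] by (auto simp: inj_on_def node_def J_def)
  interpret shrinking_nodes n A
  proof
    show "card A = ?N" unfolding A_def card_image[OF inj] J(2) ..
    show "cmod a \<le> 1" if "a \<in> A" for a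
      using that by (auto simp: A_def node_def norm_mult chebyshev_node_def)
  qed (rule assms)
  \<comment> \<open>On the imaginary axis the node polynomial of the complex nodes is a real Chebyshev polynomial up to
    a factor of modulus \<open>4 ^ - n\<close>.\<close>
  have W: "(\<Prod>a\<in>A. \<i> * of_real x - a) = \<i> ^ ?N * of_real (poly (cheb_poly ?N) x / 4 ^ n)" for x
  proof -
    have "(\<Prod>a\<in>A. \<i> * of_real x - a) = (\<Prod>j\<in>J. \<i> * of_real (x - chebyshev_node n j))"
      unfolding A_def prod.reindex[OF inj] by (simp add: node_def algebra_simps)
    also have "\<dots> = \<i> ^ ?N * of_real (\<Prod>j\<in>J. x - chebyshev_node n j)"
      unfolding prod.distrib prod_constant J(2) of_real_prod ..
    finally show ?thesis unfolding J_def chebyshev_node_polynomial .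
  qed
  obtain C \<delta> where C: "\<delta> > 0" "\<And>\<omega> p q z. 0 < \<omega> \<Longrightarrow> \<omega> < \<delta> \<Longrightarrow> interpolates \<omega> p q \<Longrightarrow> cmod z \<le> 1 \<Longrightarrow>
      poly q z \<noteq> 0 \<and>
        cmod (exp (of_real \<omega> * z) - poly p z / poly q z - \<kappa> * of_real \<omega> ^ ?N * (\<Prod>a\<in>A. z - a))
          \<le> C * \<omega> ^ (2 * n + 2)"
    using interpolation_error_expansion by blast
  have bound: "\<bar>approx_error (rational_interpolant n (chebyshev_node n) \<omega>) \<omega>
            - 2 * (fact n)^2 / (fact (2 * n) * fact (2 * n + 1)) * (\<omega> / 2) ^ ?N\<bar> \<le> C * \<omega> ^ (2 * n + 2)"
    if \<omega>: "0 < \<omega>" "\<omega> < \<delta>" for \<omega>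
  proof -
    let ?r = "rational_interpolant n (chebyshev_node n) \<omega>"
    obtain p q where pq: "solves_linearized n (chebyshev_node n) \<omega> p q"
      using linearized_interpolation_solvable[of J n node "\<lambda>j. exp (\<i> * of_real (\<omega> * chebyshev_node n j))"] J
      unfolding solves_linearized_def J_def node_def by auto
    then have int: "interpolates \<omega> p q"
      unfolding solves_linearized_def interpolates_def by (auto simp: A_def J_def node_def mult_ac)
    define c where "c = cmod \<kappa> * \<omega> ^ ?N / 4 ^ n"
    have "c \<ge> 0" using \<omega> by (simp add: c_def)
    have "\<bar>cmod (?r (\<i> * of_real x) - exp (\<i> * of_real (\<omega> * x))) - c * \<bar>poly (cheb_poly ?N) x\<bar>\<bar>
        \<le> C * \<omega> ^ (2 * n + 2)" if x: "x \<in> {-1..1}" for x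
    proof -
      have z: "cmod (\<i> * of_real x) \<le> 1" using x by (simp add: norm_mult abs_le_iff)
      note * = C(2)[OF \<omega> int z]
      have r: "?r (\<i> * of_real x) = poly p (\<i> * of_real x) / poly q (\<i> * of_real x)"
        using * by (intro rational_interpolant_eq_quotient[OF inj_chebyshev_node pq]) simp
      have "cmod (\<kappa> * of_real \<omega> ^ ?N * (\<Prod>a\<in>A. \<i> * of_real x - a)) = c * \<bar>poly (cheb_poly ?N) x\<bar>"
        unfolding W using \<omega> by (simp add: c_def norm_mult norm_power norm_divide del: cheb_poly.simps power_Suc)
      moreover have "cmod (?r (\<i> * of_real x) - exp (\<i> * of_real (\<omega> * x)))
          = cmod (exp (of_real \<omega> * (\<i> * of_real x)) - poly p (\<i> * of_real x) / poly q (\<i> * of_real x))"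
        unfolding r by (subst norm_minus_commute) (simp add: mult_ac)
      moreover have "\<bar>cmod u - cmod v\<bar> \<le> C * \<omega> ^ (2 * n + 2)" if "cmod (u - v) \<le> C * \<omega> ^ (2 * n + 2)" for u v
        using norm_triangle_ineq3[of u v] that by linarith
      ultimately show ?thesis using * by metis
    qed
    moreover have "bdd_above ((\<lambda>x. c * \<bar>poly (cheb_poly ?N) x\<bar>) ` {-1..1})"
      by (intro compact_imp_bounded[THEN bounded_imp_bdd_above] compact_continuous_image continuous_intros) auto
    ultimately have "\<bar>(SUP x\<in>{-1..1}. cmod (?r (\<i> * of_real x) - exp (\<i> * of_real (\<omega> * x))))
        - (SUP x\<in>{-1..1}. c * \<bar>poly (cheb_poly ?N) x\<bar>)\<bar> \<le> C * \<omega> ^ (2 * n + 2)"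
      by (intro abs_SUP_diff_le) auto
    moreover have "(SUP x\<in>{-1..1}. c * \<bar>poly (cheb_poly ?N) x\<bar>) = c"
      by (rule SUP_scaled_abs_cheb_poly[OF \<open>c \<ge> 0\<close>])
    moreover have "c = 2 * (fact n)^2 / (fact (2 * n) * fact (2 * n + 1)) * (\<omega> / 2) ^ ?N"
      using norm_pade_remainder_leading_coeff[OF assms]
      by (simp add: c_def kappa_def power_divide power_mult del: fact_Suc)
    ultimately show ?thesis by (simp add: approx_error_def)
  qed
  show ?thesis
  proof (rule bigoI[of _ C])
    show "\<forall>\<^sub>F \<omega> in at_right 0. norm (approx_error (rational_interpolant n (chebyshev_node n) \<omega>) \<omega>
            - 2 * (fact n)^2 / (fact (2 * n) * fact (2 * n + 1)) * (\<omega> / 2) ^ (2 * n + 1))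
          \<le> C * norm (\<omega> ^ (2 * n + 2))"
      using eventually_at_right_real[OF C(1)] by eventually_elim (use bound in simp)
  qed
qed

end
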